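(* Consider statistical models $\{P^{(n)}_{\theta,\eta}:\theta\in\Theta,\eta\in\mathcal H\}$ with a product prior $\Pi=\Pi_\Theta\times\Pi_{\mathcal H}$, and suppose $\Pi_\Theta$ is thick at $\theta_0$. Suppose there exist measurable subsets $\mathcal H_n\subset\mathcal H$, componentwise $L_2(P_0^{(n)})$ random vectors $\dot\ell^{(n)}_{\theta_0,\eta}(X^{(n)})\in\mathbb R^p$ ($\eta\in\mathcal H$) and $p\times p$ matrices $V_{n,\eta}$ such that: (i) (misspecified LAN) for every compact $K\subset\mathbb R^p$, $$\sup_{h\in K}\sup_{\eta\in\mathcal H_n}\Big|\log\frac{p^{(n)}_{\theta_0+h/\sqrt n,\eta}}{p^{(n)}_{\theta_0,\eta}}(X^{(n)})-\frac{h^T}{\sqrt n}\dot\ell^{(n)}_{\theta_0,\eta}(X^{(n)})+\tfrac12h^TV_{n,\eta}h\Big|=o_{P_0}(1);$$ (ii) (Condition A) $\sup_{\eta\in\mathcal H_n}|\dot\ell^{(n)}_{\theta_0,\eta}(X^{(n)})-\dot\ell^{(n)}_{\theta_0,\eta_0}(X^{(n)})|=o_{P_0}(n^{1/2})$, $\sup_{\eta\in\mathcal H_n}\|V_{n,\eta}-V_{n,\eta_0}\|=o(1)$, and $0<\liminf_n\rho_{\min}(V_{n,\eta_0})\le\limsup_n\rho_{\max}(V_{n,\eta_0})<\infty$; (iii) (Condition B) $P_0^{(n)}\Pi(\eta\in\mathcal H_n\mid X^{(n)})\to1$, and $P_0^{(n)}\Pi(\sqrt n|\theta-\theta_0|>M_n\mid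 X^{(n)})\to0$ for every sequence $M_n\uparrow\infty$. Then $$\sup_B\Big|\Pi\big(\sqrt n(\theta-\theta_0)\in B\mid X^{(n)}\big)-N_{\Delta_n,V_{n,\eta_0}^{-1}}(B)\Big|\to0$$ in $P_0^{(n)}$-probability, where the supremum is over Borel sets $B\subset\mathbb R^p$, $N_{\mu,\Sigma}$ is the normal distribution with mean $\mu$ and covariance $\Sigma$, and $\Delta_n=n^{-1/2}V_{n,\eta_0}^{-1}\dot\ell^{(n)}_{\theta_0,\eta_0}(X^{(n)})$.
   Context: For each $n$, $\mathscr P^{(n)}=\{P^{(n)}_{\theta,\eta}:\theta\in\Theta,\eta\in\mathcal H\}$ is a model on a measurable space $(\mathscr X^{(n)},\mathscr A^{(n)})$, with $\Theta\subset\mathbb R^p$ and $\mathcal H$ a metric space with its Borel $\sigma$-algebra; $P^{(n)}_{\theta,\eta}$ has density $p^{(n)}_{\theta,\eta}$ with respect to a $\sigma$-finite measure $\mu^{(n)}$. The observation $X^{(n)}$ has law $P_0^{(n)}=P^{(n)}_{\theta_0,\eta_0}$ for some $\theta_0\in\Theta$, $\eta_0\in\mathcal H$. $\Pi(\cdot\mid X^{(n)})$ is the posterior. A prior $\Pi_\Theta$ is thick at $\theta_0$ if it has a strictly positive continuous Lebesgue density on a neighbourhood of $\theta_0$. $\|A\|$ is the operator norm; $\rho_{\min},\rho_{\max}$ are minimum and maximum eigenvalues; $|\cdot|$ is the Euclidean norm. *)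

theory Defs
  imports "HOL-Probability.Probability"
begin

definition outer_prob :: "'a measure \<Rightarrow> 'a set \<Rightarrow> real" where
  "outer_prob M A = Inf {measure M B | B. B \<in> sets M \<and> A \<inter> space M \<subseteq> B}"

definition thick_at :: "(real ^ 'p) measure \<Rightarrow> real ^ 'p \<Rightarrow> bool" where
  "thick_at Pi0 \<theta>0 \<longleftrightarrow>
     (\<exists>U f. open U \<and> \<theta>0 \<in> U \<and> continuous_on U f \<and> (\<forall>t\<in>U. f t > (0::real)) \<and>
        (\<forall>A\<in>sets borel. A \<subseteq> U \<longrightarrow> emeasure Pi0 A = (\<integral>\<^sup>+ t\<in>A. ennreal (f t) \<partial>lborel)))"

definition real_eigenvalues :: "real ^ 'n ^ 'n \<Rightarrow> real set" where
  "real_eigenvalues A = {l. \<exists>v. v \<noteq> 0 \<and> A *v v = l *\<^sub>R v}"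

definition rho_min :: "real ^ 'n ^ 'n \<Rightarrow> real" where
  "rho_min A = Min (real_eigenvalues A)"

definition rho_max :: "real ^ 'n ^ 'n \<Rightarrow> real" where
  "rho_max A = Max (real_eigenvalues A)"

definition mvnormal_density :: "real ^ 'p \<Rightarrow> real ^ 'p ^ 'p \<Rightarrow> real ^ 'p \<Rightarrow> real" where
  "mvnormal_density \<mu> \<Sigma> y =
     exp (- ((y - \<mu>) \<bullet> (matrix_inv \<Sigma> *v (y - \<mu>))) / 2)
       / sqrt ((2 * pi) ^ CARD('p) * det \<Sigma>)"

definition mvnormal :: "real ^ 'p \<Rightarrow> real ^ 'p ^ 'p \<Rightarrow> (real ^ 'p) measure" where
  "mvnormal \<mu> \<Sigma> = density lborel (\<lambda>y. ennreal (mvnormal_density \<mu> \<Sigma> y))"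

definition posterior ::
  "(('t \<times> 'h) measure) \<Rightarrow> (nat \<Rightarrow> 't \<Rightarrow> 'h \<Rightarrow> 'x \<Rightarrow> real) \<Rightarrow> nat \<Rightarrow> ('t \<times> 'h) set \<Rightarrow> 'x \<Rightarrow> real"
  where
  "posterior Prior p n A x =
     enn2real (\<integral>\<^sup>+ z. indicator A z * ennreal (p n (fst z) (snd z) x) \<partial>Prior)
       / enn2real (\<integral>\<^sup>+ z. ennreal (p n (fst z) (snd z) x) \<partial>Prior)"

end

theory Submission
  imports Defs
begin

text \<open>
  Condition B yields a fixed radius \<open>M0\<close> such that, with probability close to one, most posterior mass of
  \<open>h = sqrt n (\<theta> - \<theta>0)\<close> lies in the ball of radius \<open>M0\<close>. On a larger ball of radius \<open>M\<close>, a fixed multiple of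
  \<open>M0\<close>, the LAN expansion, Condition A and the continuity of the prior density show that, uniformly in
  \<open>\<eta> \<in> H n\<close>, the unnormalised posterior is up to a factor close to one a constant multiple of
  \<open>N(\<Delta>, V\<^sup>-\<^sup>1)\<close>; integrating out \<open>\<eta>\<close> only changes the constant. So the posterior is close to the normal
  law conditioned on the larger ball.

  Tightness of \<open>\<Delta>\<close> is not assumed. It follows because a normal law whose mean is far from the
  ball of radius \<open>M0\<close> gives a disjoint translate of this ball inside the larger one at least the same mass,
  contradicting that almost all the conditioned mass sits in the ball of radius \<open>M0\<close>. Hence \<open>\<Delta>\<close> is
  bounded by \<open>M / 2\<close> and the normal mass outside the larger ball is negligible.
\<close>


subsection \<open>Spectral decomposition of symmetric matrices\<close>

text \<open>The suprema run over uncountable families, so the exceptional events need not be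
  measurable; hence the outer probabilities. The comparison with the normal law,
  \<open>posterior_normal_distance\<close>, concerns one fixed observation; probability enters only
  through five exceptional events whose outer probabilities are added up.

  The LAN ratio is relative to the likelihood at (\<theta>0, \<eta>), which may vary wildly with
  \<eta>. As this factor does not depend on \<open>h\<close>, it is integrated over
  \<open>H n\<close> separately and ends up in a constant that cancels in the normalisation.

  The radii satisfy M = 2 * (3 + 4 * lmax / lmin) * M0. A mean of norm at least (3 + 4 * lmax /
  lmin) * M0 forces the doubling; the factor 2 keeps any other mean at distance at least M / 2 from
  the outside of the larger ball K, as the Gaussian tail bound needs. With K0 the ball of radius M0,
  doubling says N(K) >= 2 N(K0), whereas concentration says 3/4 N(K) <= 9/8 N(K0); the bounds
  \<delta> <= 1/8 and 9/8 on the squared likelihood factor are chosen to make these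
  incompatible.\<close>

lemma quadratic_form_nonneg_imp_linear_coeff_zero:
  fixes a b :: real
  assumes "\<And>t. 2 * t * a + t\<^sup>2 * b \<ge> 0"
  shows "a = 0"
proof (rule ccontr)
  assume "a \<noteq> 0"
  \<comment> \<open>The minimiser \<open>- a / b\<close> of the quadratic, with a denominator that
    is positive whatever \<open>b\<close> is; the value there is at most
    \<open>t * a < 0\<close>.\<close>
  define t where "t = - a / (\<bar>b\<bar> + 1)"
  have "t\<^sup>2 * b \<le> t\<^sup>2 * (\<bar>b\<bar> + 1)"
    by (intro mult_left_mono) auto
  also have "\<dots> = - t * a"
    by (simp add: t_def power2_eq_square divide_simps)
  finally have "2 * t * a + t\<^sup>2 * b \<le> t * a" by linarith
  moreover have "t * a = - (a\<^sup>2 / (\<bar>b\<bar> + 1))"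
    by (simp add: t_def power2_eq_square)
  then have "t * a < 0"
    using \<open>a \<noteq> 0\<close> by (simp add: add_nonneg_pos)
  ultimately show False using assms[of t] by linarith
qed

text \<open>The eigenvector is a maximiser of the Rayleigh quotient on the unit sphere of \<open>S\<close>.\<close>

lemma self_adjoint_eigenvector_in_subspace:
  fixes f :: "'a::euclidean_space \<Rightarrow> 'a"
  assumes f: "linear f" and adj: "\<And>x y. f x \<bullet> y = x \<bullet> f y"
    and S: "subspace S" "S \<noteq> {0}" and inv: "\<And>x. x \<in> S \<Longrightarrow> f x \<in> S"
  obtains v l where "v \<in> S" "norm v = 1" "f v = l *\<^sub>R v"
proof -
  have "compact (S \<inter> sphere 0 1)"
    using S by (simp add: closed_subspace closed_Int_compact)
  moreover obtain w where w: "w \<in> S" "w \<noteq> 0" using S subspace_0 by blast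
  then have "w /\<^sub>R norm w \<in> S \<inter> sphere 0 1" using S by (simp add: subspace_scale)
  then have "S \<inter> sphere 0 1 \<noteq> {}" by blast
  moreover have "continuous_on (S \<inter> sphere 0 1) (\<lambda>x. x \<bullet> f x)"
    by (intro continuous_intros linear_continuous_on) (use f linear_conv_bounded_linear in blast)
  ultimately obtain v where v: "v \<in> S \<inter> sphere 0 1"
    and max: "\<And>x. x \<in> S \<inter> sphere 0 1 \<Longrightarrow> x \<bullet> f x \<le> v \<bullet> f v"
    using continuous_attains_sup by metis
  define l where "l = v \<bullet> f v"
  have vS: "v \<in> S" and vv: "v \<bullet> v = 1" using v by (auto simp: norm_eq_1)
  \<comment> \<open>Homogeneity carries the maximality from the unit sphere to all of
    \<open>S\<close>.\<close>
  have q: "x \<bullet> f x \<le> l * (x \<bullet> x)" if "x \<in> S" for x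
  proof (cases "x = 0")
    case False
    have "x /\<^sub>R norm x \<in> S \<inter> sphere 0 1" using S False that by (simp add: subspace_scale)
    from max[OF this] have "(x \<bullet> f x) / (norm x)\<^sup>2 \<le> l"
      by (simp add: l_def linear_scale[OF f] power2_eq_square divide_simps)
    then show ?thesis using False by (simp add: divide_simps power2_norm_eq_inner)
  qed (simp add: linear_0[OF f])
  \<comment> \<open>First-order condition: \<open>l * (x \<bullet> x) - x \<bullet> f x\<close> is
    nonnegative on \<open>S\<close> and vanishes at \<open>v\<close>, so its derivative at
    \<open>v\<close> is zero in every direction of \<open>S\<close>.\<close>
  have "w \<bullet> (l *\<^sub>R v - f v) = 0" if "w \<in> S" for w
  proof (rule quadratic_form_nonneg_imp_linear_coeff_zero)
    fix t :: real
    have "v + t *\<^sub>R w \<in> S" using that vS S by (simp add: subspace_add subspace_scale)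
    from q[OF this] show "2 * t * (w \<bullet> (l *\<^sub>R v - f v)) + t\<^sup>2 * (l * (w \<bullet> w) - w \<bullet> f w) \<ge> 0"
      using adj[of v w]
      by (simp add: linear_add[OF f] linear_scale[OF f] inner_simps l_def[symmetric] vv
          power2_eq_square algebra_simps inner_commute)
  qed
  \<comment> \<open>The residual lies in \<open>S\<close> itself and is therefore orthogonal to
    itself.\<close>
  moreover have "l *\<^sub>R v - f v \<in> S" using inv vS S by (simp add: subspace_diff subspace_scale)
  ultimately have "l *\<^sub>R v - f v = 0" using inner_eq_zero_iff by blast
  then show ?thesis using that[of v l] vS v by simp
qed

text \<open>A largest orthonormal family of eigenvectors must be a basis: its orthogonal complement
  is invariant by self-adjointness, so a nonzero complement would contain one more
  eigenvector.\<close>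

lemma self_adjoint_orthonormal_eigenbasis:
  fixes f :: "'a::euclidean_space \<Rightarrow> 'a"
  assumes f: "linear f" and adj: "\<And>x y. f x \<bullet> y = x \<bullet> f y"
  obtains B where "pairwise orthogonal B" "\<And>b. b \<in> B \<Longrightarrow> norm b = 1 \<and> (\<exists>l. f b = l *\<^sub>R b)"
    "finite B" "card B = DIM('a)"
proof -
  define good where "good B \<longleftrightarrow> pairwise orthogonal B \<and> (\<forall>b\<in>B. norm b = 1 \<and> (\<exists>l. f b = l *\<^sub>R b))" for B
  have indep: "independent B" if "good B" for B
    using that by (intro pairwise_orthogonal_independent) (auto simp: good_def)
  have bd: "finite B \<and> card B \<le> DIM('a)" if "good B" for B
    using independent_bound[OF indep[OF that]] .
  have "good {}" by (simp add: good_def)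
  then have "\<exists>B. good B \<and> (\<forall>B'. good B' \<longrightarrow> card B' \<le> card B)"
    using bd by (intro ex_has_greatest_nat[where b="Suc DIM('a)"]) (auto simp: less_Suc_eq_le)
  then obtain B where B: "good B" and max: "\<And>B'. good B' \<Longrightarrow> card B' \<le> card B" by blast
  define S where "S = {y. \<forall>x\<in>B. orthogonal x y}"
  have "S = {0}"
  proof (rule ccontr)
    assume "S \<noteq> {0}"
    have inv: "f y \<in> S" if "y \<in> S" for y
      unfolding S_def
    proof safe
      fix x assume "x \<in> B"
      then obtain l where "f x = l *\<^sub>R x" using B by (auto simp: good_def)
      then show "orthogonal x (f y)"
        using adj[of x y] \<open>x \<in> B\<close> that by (simp add: orthogonal_def S_def)
    qed
    obtain v l where v: "v \<in> S" "norm v = 1" "f v = l *\<^sub>R v"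
      using self_adjoint_eigenvector_in_subspace[OF f adj _ \<open>S \<noteq> {0}\<close> inv]
        subspace_orthogonal_to_vectors[of B] S_def by blast
    have "v \<notin> B" using v by (auto simp: S_def orthogonal_def norm_eq_1)
    have "good (insert v B)"
      using B v by (auto simp: good_def pairwise_insert S_def orthogonal_commute)
    from max[OF this] show False using \<open>v \<notin> B\<close> bd[OF B] by simp
  qed
  have "span B = UNIV"
  proof (rule ccontr)
    assume "span B \<noteq> UNIV"
    then obtain u where "u \<noteq> 0" "\<And>y. y \<in> span B \<Longrightarrow> orthogonal u y"
      using orthogonal_to_subspace_exists_gen[of B UNIV] by auto
    then have "u \<in> S" by (simp add: S_def orthogonal_commute span_base)
    with \<open>S = {0}\<close> \<open>u \<noteq> 0\<close> show False by simp
  qed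
  then have "card B = DIM('a)" using indep[OF B] by (metis dim_UNIV dim_span_eq_card_independent)
  then show ?thesis using that B bd by (auto simp: good_def)
qed

section \<open>Orthogonal diagonalisation and the extreme eigenvalues\<close>

definition diag_matrix :: "('n \<Rightarrow> real) \<Rightarrow> real ^ 'n ^ 'n" where
  "diag_matrix d = (\<chi> i j. if i = j then d i else 0)"

lemma diag_matrix_mult_vec: "diag_matrix d *v x = (\<chi> i. d i * x $ i)"
  by (simp add: diag_matrix_def matrix_vector_mult_def vec_eq_iff if_distrib[of "\<lambda>u. u * _"] cong: if_cong)

lemma det_diag_matrix: "det (diag_matrix d) = (\<Prod>i\<in>UNIV. d i)"
  by (subst det_diagonal) (auto simp: diag_matrix_def)

text \<open>The columns of \<open>P\<close> are an orthonormal eigenbasis, so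
  \<open>A ** P = P ** diag_matrix d\<close> holds column by column.\<close>

lemma symmetric_matrix_diagonalisation:
  fixes A :: "real ^ 'n ^ 'n"
  assumes A: "transpose A = A"
  obtains P d where "orthogonal_matrix P" "A = P ** diag_matrix d ** transpose P"
proof -
  have "(A *v x) \<bullet> y = x \<bullet> (A *v y)" for x y
    by (metis A dot_lmul_matrix vector_transpose_matrix)
  then obtain B where B: "pairwise orthogonal B" "\<And>b. b \<in> B \<Longrightarrow> norm b = 1 \<and> (\<exists>l. A *v b = l *\<^sub>R b)"
    "finite B" "card B = DIM(real ^ 'n)"
    using self_adjoint_orthonormal_eigenbasis[of "(*v) A"] by auto
  then obtain g where g: "bij_betw g (UNIV :: 'n set) B"
    using finite_same_card_bij[of "UNIV :: 'n set" B] by auto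
  define P where "P = (\<chi> i j. g j $ i)"
  have gB: "g i \<in> B" for i using g by (auto simp: bij_betw_def)
  then have "\<forall>i. \<exists>l. A *v g i = l *\<^sub>R g i" using B(2) by blast
  then obtain d where d: "\<And>i. A *v g i = d i *\<^sub>R g i" by metis
  have col: "column i P = g i" for i by (simp add: column_def P_def vec_eq_iff)
  have P: "orthogonal_matrix P"
    unfolding orthogonal_matrix_orthonormal_columns col
    using B(1,2) gB g unfolding pairwise_def bij_betw_def inj_on_def by (metis UNIV_I)
  have "(A ** P) $ i $ j = (P ** diag_matrix d) $ i $ j" for i j
  proof -
    have "(A ** P) $ i $ j = (A *v g j) $ i"
      by (simp add: matrix_matrix_mult_def matrix_vector_mult_def P_def)
    also have "\<dots> = (P ** diag_matrix d) $ i $ j"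
      by (simp add: d matrix_matrix_mult_def diag_matrix_def P_def if_distrib[of "\<lambda>u. _ * u"] cong: if_cong)
    finally show ?thesis .
  qed
  then have "A ** P = P ** diag_matrix d" by (simp add: vec_eq_iff)
  then have "A = P ** diag_matrix d ** transpose P"
    using P by (metis matrix_mul_assoc matrix_mul_rid orthogonal_matrix_def)
  with P show ?thesis by (rule that)
qed

lemma orthogonal_matrix_cancel [simp]:
  fixes P :: "real ^ 'n ^ 'n"
  assumes "orthogonal_matrix P"
  shows "(P *v x) v* P = x" "P *v (x v* P) = x"
  using assms
  by (simp_all add: matrix_vector_mul_assoc orthogonal_matrix_def flip: transpose_matrix_vector)

lemma quadratic_form_diagonalised:
  fixes P :: "real ^ 'n ^ 'n"
  assumes P: "orthogonal_matrix P"
  shows "(P *v y) \<bullet> ((P ** diag_matrix d ** transpose P) *v (P *v y)) = (\<Sum>i\<in>UNIV. d i * (y $ i)\<^sup>2)"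
proof -
  have "(P ** diag_matrix d ** transpose P) *v (P *v y) = P *v (diag_matrix d *v y)"
    using P by (simp flip: matrix_vector_mul_assoc)
  also have "(P *v y) \<bullet> \<dots> = ((P *v y) v* P) \<bullet> (diag_matrix d *v y)"
    by (metis dot_lmul_matrix transpose_matrix_vector inner_commute)
  finally show ?thesis
    using P by (simp add: diag_matrix_mult_vec inner_vec_def power2_eq_square algebra_simps)
qed

lemma orthogonal_matrix_norm:
  fixes P :: "real ^ 'n ^ 'n"
  assumes "orthogonal_matrix P"
  shows "norm (P *v y) = norm y"
  using assms orthogonal_transformation_matrix[of "(*v) P"] orthogonal_transformation_norm
  by auto

text \<open>\<open>Min\<close> and \<open>Max\<close> in \<open>rho_min\<close> and
  \<open>rho_max\<close> are informative only on finite nonempty sets; together with the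
  diagonalisation this supplies such a set for every symmetric matrix.\<close>

lemma real_eigenvalues_diagonalised:
  fixes P :: "real ^ 'n ^ 'n"
  assumes P: "orthogonal_matrix P"
  shows "real_eigenvalues (P ** diag_matrix d ** transpose P) = range d"
proof safe
  fix l assume "l \<in> real_eigenvalues (P ** diag_matrix d ** transpose P)"
  then obtain v where v: "v \<noteq> 0" "P *v (diag_matrix d *v (v v* P)) = l *\<^sub>R v"
    by (auto simp: real_eigenvalues_def simp flip: matrix_vector_mul_assoc)
  define y where "y = v v* P"
  have "(l *\<^sub>R v) v* P = l *\<^sub>R y"
    by (simp add: y_def matrix_vector_mult_scaleR flip: transpose_matrix_vector)
  then have eq: "diag_matrix d *v y = l *\<^sub>R y" using v(2) P by (metis orthogonal_matrix_cancel(1) y_def)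
  have "y \<noteq> 0" using v(1) P by (metis y_def matrix_vector_mult_0_right orthogonal_matrix_cancel(2))
  then obtain i where "y $ i \<noteq> 0" by (metis vec_eq_iff zero_index)
  then show "l \<in> range d" using arg_cong[OF eq, of "\<lambda>z. z $ i"] by (auto simp: diag_matrix_mult_vec)
next
  fix i
  have "diag_matrix d *v axis i 1 = d i *\<^sub>R axis i 1"
    by (simp add: diag_matrix_mult_vec vec_eq_iff axis_def)
  then have "(P ** diag_matrix d ** transpose P) *v (P *v axis i 1) = d i *\<^sub>R (P *v axis i 1)"
    using P by (simp add: matrix_vector_mult_scaleR flip: matrix_vector_mul_assoc)
  moreover have "P *v axis i 1 \<noteq> 0"
    using orthogonal_matrix_norm[OF P, of "axis i 1"] by auto
  ultimately show "d i \<in> real_eigenvalues (P ** diag_matrix d ** transpose P)"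
    unfolding real_eigenvalues_def by blast
qed

text \<open>In the coordinates of an orthonormal eigenbasis the form is a sum of squares weighted by
  the eigenvalues, and the norm is unchanged; every weight lies between the extreme ones.\<close>

lemma
  fixes A :: "real ^ 'n ^ 'n"
  assumes A: "transpose A = A"
  shows rho_min_le_quadratic_form: "rho_min A * (norm x)\<^sup>2 \<le> x \<bullet> (A *v x)"
    and quadratic_form_le_rho_max: "x \<bullet> (A *v x) \<le> rho_max A * (norm x)\<^sup>2"
proof -
  obtain P d where P: "orthogonal_matrix P" and A_eq: "A = P ** diag_matrix d ** transpose P"
    using symmetric_matrix_diagonalisation[OF A] .
  define y where "y = x v* P"
  have x: "x = P *v y" using P by (simp add: y_def)
  have n: "(norm x)\<^sup>2 = (\<Sum>i\<in>UNIV. (y $ i)\<^sup>2)"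
    unfolding x orthogonal_matrix_norm[OF P] 
    by (simp only: power2_norm_eq_inner inner_vec_def inner_real_def) (simp add: power2_eq_square)
  have q: "x \<bullet> (A *v x) = (\<Sum>i\<in>UNIV. d i * (y $ i)\<^sup>2)"
    unfolding x A_eq by (rule quadratic_form_diagonalised[OF P])
  have r: "rho_min A = Min (range d)" "rho_max A = Max (range d)"
    by (simp_all add: rho_min_def rho_max_def A_eq real_eigenvalues_diagonalised[OF P])
  show "rho_min A * (norm x)\<^sup>2 \<le> x \<bullet> (A *v x)"
    unfolding n q sum_distrib_left r by (intro sum_mono mult_right_mono) auto
  show "x \<bullet> (A *v x) \<le> rho_max A * (norm x)\<^sup>2"
    unfolding n q sum_distrib_left r by (intro sum_mono mult_right_mono) auto
qed

subsection \<open>The Gaussian integral\<close>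

lemma nn_integral_lborel_shift:
  fixes f :: "'a::euclidean_space \<Rightarrow> ennreal"
  assumes [measurable]: "f \<in> borel_measurable borel"
  shows "(\<integral>\<^sup>+ x. f (x + t) \<partial>lborel) = (\<integral>\<^sup>+ x. f x \<partial>lborel)"
proof -
  have "(\<integral>\<^sup>+ x. f x \<partial>lborel) = (\<integral>\<^sup>+ x. f x \<partial>distr lborel borel ((+) t))"
    by (simp add: lborel_distr_plus)
  also have "\<dots> = (\<integral>\<^sup>+ x. f (x + t) \<partial>lborel)"
    by (subst nn_integral_distr) (auto simp: add.commute)
  finally show ?thesis by simp
qed

lemma nn_integral_lborel_affine:
  fixes f :: "'a::euclidean_space \<Rightarrow> ennreal"
  assumes [measurable]: "f \<in> borel_measurable borel" and "c \<noteq> 0"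
  shows "(\<integral>\<^sup>+ x. f x \<partial>lborel) = ennreal (\<bar>c\<bar> ^ DIM('a)) * (\<integral>\<^sup>+ x. f (t + c *\<^sub>R x) \<partial>lborel)"
  by (subst lborel_affine[OF \<open>c \<noteq> 0\<close>, of t])
    (simp add: nn_integral_density nn_integral_distr nn_integral_cmult)

text \<open>The uniqueness argument for Haar measure, with the unit ball as the invariant test set.\<close>

lemma nn_integral_lborel_orthogonal:
  fixes f :: "'a::euclidean_space \<Rightarrow> ennreal"
    and T :: "'a \<Rightarrow> 'a"
  assumes T: "orthogonal_transformation T" and f[measurable]: "f \<in> borel_measurable borel"
  shows "(\<integral>\<^sup>+ x. f (T x) \<partial>lborel) = (\<integral>\<^sup>+ x. f x \<partial>lborel)"
proof -
  have lin: "linear T" using T by (rule orthogonal_transformation_linear)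
  have [measurable]: "T \<in> borel_measurable borel"
    using linear_continuous_on[of T UNIV] lin linear_conv_bounded_linear
    by (intro borel_measurable_continuous_onI) blast
  have surj: "T (inv T y) = y" for y
    by (rule surj_f_inv_f[OF orthogonal_transformation_surj[OF T]])
  define g :: "'a \<Rightarrow> ennreal" where "g = indicator (cball 0 1)"
  define \<beta> where "\<beta> = emeasure lborel (cball (0::'a) 1)"
  have [measurable]: "g \<in> borel_measurable borel"
    unfolding g_def by (intro borel_measurable_indicator) simp
  have vol: "emeasure lborel (cball (c::'a) 1) = \<beta>" for c
    by (simp add: \<beta>_def emeasure_cball)
  \<comment> \<open>A shift of \<open>T x\<close> by \<open>y\<close> is a shift of \<open>x\<close>
    by \<open>inv T y\<close>, so averaging over \<open>y\<close> with weight \<open>g\<close> may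
    use \<open>f (T x + y)\<close> instead of \<open>f (T x)\<close>. Exchanging the integrals then
    allows the shift to be moved from \<open>f\<close> to \<open>g\<close>.\<close>
  have "\<beta> * (\<integral>\<^sup>+ x. f (T x) \<partial>lborel) = (\<integral>\<^sup>+ y. g y * (\<integral>\<^sup>+ x. f (T x) \<partial>lborel) \<partial>lborel)"
    by (subst nn_integral_multc, simp) (simp add: g_def \<beta>_def)
  also have "\<dots> = (\<integral>\<^sup>+ y. \<integral>\<^sup>+ x. g y * f (T x + y) \<partial>lborel \<partial>lborel)"
  proof (rule nn_integral_cong)
    fix y
    have "(\<integral>\<^sup>+ x. f (T x + y) \<partial>lborel) = (\<integral>\<^sup>+ x. f (T (x + inv T y)) \<partial>lborel)"
      by (simp add: linear_add[OF lin] surj)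
    also have "\<dots> = (\<integral>\<^sup>+ x. f (T x) \<partial>lborel)"
      by (rule nn_integral_lborel_shift) simp
    finally show "g y * (\<integral>\<^sup>+ x. f (T x) \<partial>lborel) = (\<integral>\<^sup>+ x. g y * f (T x + y) \<partial>lborel)"
      by (simp add: nn_integral_cmult)
  qed
  also have "\<dots> = (\<integral>\<^sup>+ x. \<integral>\<^sup>+ y. g y * f (T x + y) \<partial>lborel \<partial>lborel)"
    by (rule lborel_pair.Fubini') simp
  also have "\<dots> = (\<integral>\<^sup>+ x. \<integral>\<^sup>+ y. g (y - T x) * f y \<partial>lborel \<partial>lborel)"
  proof (rule nn_integral_cong)
    fix x
    show "(\<integral>\<^sup>+ y. g y * f (T x + y) \<partial>lborel) = (\<integral>\<^sup>+ y. g (y - T x) * f y \<partial>lborel)"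
      using nn_integral_lborel_shift[of "\<lambda>y. g (y - T x) * f y" "T x"] by (simp add: add.commute)
  qed
  also have "\<dots> = (\<integral>\<^sup>+ y. \<integral>\<^sup>+ x. g (y - T x) * f y \<partial>lborel \<partial>lborel)"
    by (rule lborel_pair.Fubini') simp
  \<comment> \<open>For fixed \<open>y\<close> the points \<open>x\<close> with
    \<open>y - T x\<close> in the unit ball form the unit ball about \<open>inv T y\<close>, because
    \<open>T\<close> preserves norms; its volume is again \<open>\<beta>\<close>.\<close>
  also have "\<dots> = (\<integral>\<^sup>+ y. \<beta> * f y \<partial>lborel)"
  proof (rule nn_integral_cong)
    fix y
    have "g (y - T x) = indicator (cball (inv T y) 1) x" for x
    proof -
      have "norm (y - T x) = norm (T (inv T y - x))"
        by (simp add: linear_diff[OF lin] surj)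
      also have "\<dots> = dist (inv T y) x"
        by (simp add: orthogonal_transformation_norm[OF T] dist_norm)
      finally show ?thesis by (simp add: g_def indicator_def)
    qed
    then show "(\<integral>\<^sup>+ x. g (y - T x) * f y \<partial>lborel) = \<beta> * f y"
      by (simp add: nn_integral_multc vol borel_measurable_indicator)
  qed
  also have "\<dots> = \<beta> * (\<integral>\<^sup>+ x. f x \<partial>lborel)"
    by (simp add: nn_integral_cmult)
  finally have "\<beta> * (\<integral>\<^sup>+ x. f (T x) \<partial>lborel) = \<beta> * (\<integral>\<^sup>+ x. f x \<partial>lborel)" .
  moreover have "\<beta> \<noteq> 0" "\<beta> \<noteq> \<top>" by (auto simp: \<beta>_def emeasure_cball unit_ball_vol_pos less_imp_neq[symmetric])
  ultimately show ?thesis by (simp add: ennreal_mult_cancel_left)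
qed

lemma nn_integral_exp_square:
  assumes "d > 0"
  shows "(\<integral>\<^sup>+ x. ennreal (exp (- (d * x\<^sup>2) / 2)) \<partial>lborel) = ennreal (sqrt (2 * pi / d))"
proof -
  define c where "c = sqrt (2 * pi / d)"
  have c: "c > 0" using assms by (simp add: c_def)
  interpret prob_space "density lborel (normal_density 0 (1 / sqrt d))"
    using assms by (intro prob_space_normal_density) simp
  have *: "exp (- (d * x\<^sup>2) / 2) = c * normal_density 0 (1 / sqrt d) x" for x
    using assms c by (simp add: normal_density_def c_def power_divide)
  have "(\<integral>\<^sup>+ x. ennreal (normal_density 0 (1 / sqrt d) x) \<partial>lborel) = 1"
    using emeasure_space_1 by (simp add: emeasure_density)
  then show ?thesis
    unfolding * using c by (simp add: ennreal_mult nn_integral_cmult c_def)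
qed

lemma nn_integral_exp_diagonal_form:
  fixes d :: "'n::finite \<Rightarrow> real"
  assumes d: "\<And>i. d i > 0"
  shows "(\<integral>\<^sup>+ x. ennreal (exp (- (\<Sum>i\<in>UNIV. d i * (x $ i)\<^sup>2) / 2)) \<partial>(lborel :: (real ^ 'n) measure))
    = ennreal (sqrt ((2 * pi) ^ CARD('n) / (\<Prod>i\<in>UNIV. d i)))"
proof -
  \<comment> \<open>\<open>e\<close> translates between the coordinate type and
    \<open>Basis\<close>, over which the product formula for \<open>lborel\<close> is
    indexed.\<close>
  define e where "e i = (axis i 1 :: real ^ 'n)" for i
  have inj: "inj e" by (auto simp: inj_def e_def axis_eq_axis)
  have basis: "(Basis :: (real ^ 'n) set) = range e" by (auto simp: Basis_vec_def e_def)
  have dot: "x \<bullet> e i = x $ i" for x i by (simp add: e_def inner_axis)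
  have "ennreal (exp (- (\<Sum>i\<in>UNIV. d i * (x $ i)\<^sup>2) / 2)) =
      (\<Prod>b\<in>Basis. ennreal (exp (- (d (inv e b) * (x \<bullet> b)\<^sup>2) / 2)))" for x
    by (simp add: basis prod.reindex[OF inj] inv_f_f[OF inj] dot exp_sum[symmetric] prod_ennreal
        sum_negf sum_divide_distrib)
  then have "(\<integral>\<^sup>+ x. ennreal (exp (- (\<Sum>i\<in>UNIV. d i * (x $ i)\<^sup>2) / 2)) \<partial>lborel) =
      (\<integral>\<^sup>+ x. (\<Prod>b\<in>Basis. ennreal (exp (- (d (inv e b) * (x \<bullet> b)\<^sup>2) / 2))) \<partial>lborel)"
    by simp
  also have "\<dots> = (\<Prod>b\<in>Basis. \<integral>\<^sup>+ x. ennreal (exp (- (d (inv e b) * x\<^sup>2) / 2)) \<partial>lborel)"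
    by (rule nn_integral_lborel_prod) auto
  also have "\<dots> = (\<Prod>i\<in>UNIV. ennreal (sqrt (2 * pi / d i)))"
    by (simp only: basis prod.reindex[OF inj] o_def inv_f_f[OF inj] nn_integral_exp_square[OF d])
  also have "\<dots> = ennreal (\<Prod>i\<in>UNIV. sqrt (2 * pi / d i))"
    using d by (intro prod_ennreal) (simp add: less_imp_le)
  also have "(\<Prod>i\<in>I. sqrt (2 * pi / d i)) = sqrt (\<Prod>i\<in>I. 2 * pi / d i)" for I
    by (induction I rule: infinite_finite_induct) (auto simp: real_sqrt_mult simp flip: times_divide_eq_left)
  finally show ?thesis by (simp add: prod_dividef)
qed

text \<open>Testing the form on the columns of \<open>P\<close> shows that all \<open>d i\<close>
  are positive. Since \<open>det P\<close> squares to 1, the determinant is their product, and the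
  orthogonal substitution \<open>x = P *v y\<close> makes the integral a product of one-dimensional
  ones.\<close>

lemma symmetric_pos_def_det_and_gaussian_integral:
  fixes A :: "real ^ 'n ^ 'n"
  assumes A: "transpose A = A" and pos: "\<And>x. x \<noteq> 0 \<Longrightarrow> x \<bullet> (A *v x) > 0"
  shows "det A > 0"
    and "(\<integral>\<^sup>+ x. ennreal (exp (- (x \<bullet> (A *v x)) / 2)) \<partial>lborel) = ennreal (sqrt ((2 * pi) ^ CARD('n) / det A))"
proof -
  obtain P d where P: "orthogonal_matrix P" and A_eq: "A = P ** diag_matrix d ** transpose P"
    using symmetric_matrix_diagonalisation[OF A] .
  have q: "(P *v y) \<bullet> (A *v (P *v y)) = (\<Sum>i\<in>UNIV. d i * (y $ i)\<^sup>2)" for y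
    unfolding A_eq by (rule quadratic_form_diagonalised[OF P])
  have "d i > 0" for i
  proof -
    have "P *v axis i 1 \<noteq> 0" using orthogonal_matrix_norm[OF P, of "axis i 1"] by auto
    from pos[OF this] show ?thesis
      by (simp add: q axis_def if_distrib[of "\<lambda>u. u\<^sup>2"] if_distrib[of "\<lambda>u. _ * u"] cong: if_cong)
  qed
  note d = this
  have "det P * det P = 1"
    using P by (metis det_I det_mul det_transpose orthogonal_matrix_def)
  then have det: "det A = (\<Prod>i\<in>UNIV. d i)"
    by (simp add: A_eq det_mul det_diag_matrix)
  then show "det A > 0" using d by (simp add: prod_pos)
  have T: "orthogonal_transformation ((*v) P)" using P by (simp add: orthogonal_transformation_matrix)
  have "(\<lambda>x. ennreal (exp (- (x \<bullet> (A *v x)) / 2))) \<in> borel_measurable borel"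
    by (intro measurable_compose[OF _ measurable_ennreal] borel_measurable_continuous_onI continuous_intros
        linear_continuous_on matrix_vector_mul_bounded_linear) auto
  from nn_integral_lborel_orthogonal[OF T this]
  show "(\<integral>\<^sup>+ x. ennreal (exp (- (x \<bullet> (A *v x)) / 2)) \<partial>lborel) = ennreal (sqrt ((2 * pi) ^ CARD('n) / det A))"
    unfolding q det nn_integral_exp_diagonal_form[OF d] by simp
qed

subsection \<open>Normal distributions with positive definite precision matrix\<close>

lemma matrix_inv_inverse:
  fixes A :: "'a::semiring_1 ^ 'n ^ 'm"
  assumes "invertible A"
  shows "A ** matrix_inv A = mat 1" "matrix_inv A ** A = mat 1"
  using someI_ex[OF assms[unfolded invertible_def]] by (simp_all add: matrix_inv_def)

lemma matrix_inv_unique_two_sided: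
  fixes A :: "'a::semiring_1 ^ 'n ^ 'm"
  assumes "A ** B = mat 1" "B ** A = mat 1"
  shows "matrix_inv A = B"
proof -
  have "invertible A" using assms unfolding invertible_def by blast
  then show ?thesis using assms matrix_inv_inverse[of A]
    by (metis matrix_mul_assoc matrix_mul_lid matrix_mul_rid)
qed

text \<open>The unnormalised centred normal density, parametrised by the precision matrix rather
  than by the covariance.\<close>

definition gauss_kernel :: "real ^ 'n ^ 'n \<Rightarrow> real ^ 'n \<Rightarrow> real" where
  "gauss_kernel V z = exp (- (z \<bullet> (V *v z)) / 2)"

lemma borel_measurable_gauss_kernel [measurable]: "gauss_kernel V \<in> borel_measurable borel"
  unfolding gauss_kernel_def
  by (intro borel_measurable_continuous_onI continuous_intros
      linear_continuous_on matrix_vector_mul_bounded_linear) auto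

lemma gauss_kernel_pos: "gauss_kernel V z > 0"
  by (simp add: gauss_kernel_def)

lemma gauss_kernel_nonneg [simp]: "gauss_kernel V z \<ge> 0"
  by (simp add: gauss_kernel_def)

text \<open>For symmetric positive definite \<open>V\<close> this is the total mass of
  \<open>gauss_kernel V\<close>.\<close>

definition gauss_const :: "real ^ 'n ^ 'n \<Rightarrow> real" where
  "gauss_const V = sqrt ((2 * pi) ^ CARD('n) / det V)"

lemma quadratic_form_add:
  fixes V :: "real ^ 'n ^ 'n"
  assumes V: "transpose V = V"
  shows "(x + y) \<bullet> (V *v (x + y)) = x \<bullet> (V *v x) + 2 * (x \<bullet> (V *v y)) + y \<bullet> (V *v y)"
proof -
  have "y \<bullet> (V *v x) = x \<bullet> (V *v y)"
    by (metis V dot_lmul_matrix vector_transpose_matrix inner_commute)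
  then show ?thesis by (simp add: matrix_vector_right_distrib inner_simps)
qed

text \<open>The bounds \<open>lmin\<close> and \<open>lmax\<close> are parameters instead of the
  eigenvalues of \<open>V\<close>: one pair serves all large \<open>n\<close> at once, so radii and
  tail bounds built from them do not depend on \<open>n\<close>.\<close>

locale pos_def_form =
  fixes V :: "real ^ 'p ^ 'p" and lmin lmax :: real
  assumes sym: "transpose V = V"
    and lmin_pos: "lmin > 0"
    and lmin_le: "\<And>x. lmin * (norm x)\<^sup>2 \<le> x \<bullet> (V *v x)"
    and le_lmax: "\<And>x. x \<bullet> (V *v x) \<le> lmax * (norm x)\<^sup>2"
begin

lemma form_pos: "x \<noteq> 0 \<Longrightarrow> x \<bullet> (V *v x) > 0"
  using lmin_le[of x] lmin_pos by (smt (verit) mult_pos_pos zero_less_norm_iff zero_less_power)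

lemma form_nonneg: "x \<bullet> (V *v x) \<ge> 0"
  using form_pos[of x] by (cases "x = 0") auto

lemma det_pos: "det V > 0"
  using symmetric_pos_def_det_and_gaussian_integral(1)[OF sym form_pos] by blast

lemma gauss_const_pos: "gauss_const V > 0"
  using det_pos by (simp add: gauss_const_def)

lemma nn_integral_gauss_kernel:
  "(\<integral>\<^sup>+ z. ennreal (gauss_kernel V z) \<partial>lborel) = ennreal (gauss_const V)"
  unfolding gauss_kernel_def gauss_const_def
  using symmetric_pos_def_det_and_gaussian_integral(2)[OF sym form_pos] by blast

lemma invertible: "invertible V"
  using det_pos by (simp add: invertible_det_nz)

text \<open>\<open>mvnormal\<close> is given a covariance and its density inverts it. With
  covariance V^-1 the exponent carries \<open>V\<close> again and the determinant is the reciprocal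
  one.\<close>

lemma mvnormal_eq:
  "mvnormal m (matrix_inv V) = density lborel (\<lambda>y. ennreal (gauss_kernel V (y - m) / gauss_const V))"
proof -
  have inv: "matrix_inv (matrix_inv V) = V"
    by (intro matrix_inv_unique_two_sided matrix_inv_inverse invertible)
  have "det (matrix_inv V) = 1 / det V"
    using arg_cong[OF matrix_inv_inverse(1)[OF invertible], of det] det_pos
    by (simp add: det_mul field_simps)
  then show ?thesis
    by (simp add: mvnormal_def mvnormal_density_def[abs_def] inv gauss_kernel_def gauss_const_def)
qed

lemma sets_mvnormal [simp]: "sets (mvnormal m \<Sigma>) = sets borel"
  by (simp add: mvnormal_def)

lemma emeasure_mvnormal:
  assumes "B \<in> sets borel"
  shows "emeasure (mvnormal m (matrix_inv V)) B =
    (\<integral>\<^sup>+ y. ennreal (gauss_kernel V (y - m) / gauss_const V) * indicator B y \<partial>lborel)"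
  unfolding mvnormal_eq using assms by (subst emeasure_density) auto

lemma prob_space_mvnormal: "prob_space (mvnormal m (matrix_inv V))"
proof
  have "emeasure (mvnormal m (matrix_inv V)) UNIV =
      (\<integral>\<^sup>+ y. ennreal (1 / gauss_const V) * ennreal (gauss_kernel V (y + - m)) \<partial>lborel)"
    using gauss_const_pos by (simp add: emeasure_mvnormal flip: ennreal_mult'')
  also have "\<dots> = ennreal (1 / gauss_const V) * ennreal (gauss_const V)"
    using nn_integral_lborel_shift[of "\<lambda>y. ennreal (gauss_kernel V y)" "- m"]
    by (simp add: nn_integral_cmult nn_integral_gauss_kernel)
  also have "\<dots> = 1" using gauss_const_pos by (simp flip: ennreal_mult)
  finally show "emeasure (mvnormal m (matrix_inv V)) (space (mvnormal m (matrix_inv V))) = 1"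
    by (simp add: mvnormal_def)
qed

text \<open>Half of the exponent is spent on the bound and half on integrability. With q the form at
  \<open>y - m\<close>, \<open>norm (y - m) \<ge> M / 2\<close> outside the ball gives exp (- q / 4)
  <= exp (- lmin * M^2 / 16). The other factor exp (- q / 4) is the kernel at
  \<open>(y - m) / sqrt 2\<close>, whose integral is larger than \<open>gauss_const V\<close> by the
  factor \<open>sqrt 2 ^ CARD('p)\<close>.\<close>

lemma mvnormal_tail:
  assumes "norm m \<le> M / 2"
  shows "measure (mvnormal m (matrix_inv V)) (- cball 0 M) \<le> sqrt 2 ^ CARD('p) * exp (- lmin * M\<^sup>2 / 16)"
proof -
  interpret N: prob_space "mvnormal m (matrix_inv V)" by (rule prob_space_mvnormal)
  let ?c = "gauss_const V" and ?s = "1 / sqrt 2 :: real" and ?E = "exp (- lmin * M\<^sup>2 / 16)"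
  have M: "M \<ge> 0" using assms norm_ge_zero[of m] by linarith
  have scaled: "(\<integral>\<^sup>+ y. ennreal (gauss_kernel V (?s *\<^sub>R (y - m))) \<partial>lborel) = ennreal (sqrt 2 ^ CARD('p) * ?c)"
  proof -
    have "ennreal ?c = ennreal (?s ^ CARD('p)) * (\<integral>\<^sup>+ y. ennreal (gauss_kernel V (?s *\<^sub>R (y - m))) \<partial>lborel)"
      using nn_integral_lborel_affine[of "\<lambda>y. ennreal (gauss_kernel V y)" ?s "- (?s *\<^sub>R m)"]
      by (simp add: nn_integral_gauss_kernel scaleR_diff_right)
    then have "ennreal (sqrt 2 ^ CARD('p)) * ennreal ?c = ennreal (sqrt 2 ^ CARD('p) * ?s ^ CARD('p)) *
        (\<integral>\<^sup>+ y. ennreal (gauss_kernel V (?s *\<^sub>R (y - m))) \<partial>lborel)"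
      by (simp add: ennreal_mult mult.assoc)
    then show ?thesis using gauss_const_pos by (simp add: ennreal_mult power_divide)
  qed
  have bound: "ennreal (gauss_kernel V (y - m) / ?c) * indicator (- cball 0 M) y
      \<le> ennreal (?E / ?c) * ennreal (gauss_kernel V (?s *\<^sub>R (y - m)))" for y
  proof (cases "y \<in> cball 0 M")
    case False
    define z where "z = y - m"
    have "norm z \<ge> M / 2" using False assms norm_triangle_ineq2[of y m] by (simp add: z_def)
    then have "(M / 2)\<^sup>2 \<le> (norm z)\<^sup>2" using M by (intro power_mono) auto
    then have "lmin * (M / 2)\<^sup>2 \<le> z \<bullet> (V *v z)"
      using lmin_pos lmin_le[of z] by (smt (verit) mult_left_mono)
    then have "exp (- (z \<bullet> (V *v z)) / 2) \<le> exp (- lmin * M\<^sup>2 / 16 + - (z \<bullet> (V *v z)) / 4)"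
      by (simp add: power_divide)
    then have "gauss_kernel V z \<le> ?E * gauss_kernel V (?s *\<^sub>R z)"
      by (simp add: gauss_kernel_def matrix_vector_mult_scaleR flip: exp_add)
    then have "gauss_kernel V z / ?c \<le> ?E / ?c * gauss_kernel V (?s *\<^sub>R z)"
      using gauss_const_pos by (simp add: divide_right_mono)
    then show ?thesis using False gauss_const_pos
      by (simp add: z_def flip: ennreal_mult'')
  qed simp
  have "emeasure (mvnormal m (matrix_inv V)) (- cball 0 M) \<le>
      (\<integral>\<^sup>+ y. ennreal (?E / ?c) * ennreal (gauss_kernel V (?s *\<^sub>R (y - m))) \<partial>lborel)"
    by (subst emeasure_mvnormal, simp) (intro nn_integral_mono bound)
  also have "\<dots> = ennreal (?E / ?c) * ennreal (sqrt 2 ^ CARD('p) * ?c)"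
    by (subst nn_integral_cmult) (simp_all add: scaled)
  also have "\<dots> = ennreal (sqrt 2 ^ CARD('p) * ?E)"
    using gauss_const_pos by (simp flip: ennreal_mult)
  finally show ?thesis by (simp add: N.emeasure_eq_measure)
qed

text \<open>If the mean is far away, translating the ball of radius \<open>r\<close> towards the mean produces a disjoint
  ball of at least the same mass.\<close>

lemma mvnormal_ball_doubling:
  assumes r: "r > 0" and m: "norm m \<ge> (3 + 4 * lmax / lmin) * r"
  shows "2 * measure (mvnormal m (matrix_inv V)) (cball 0 r) \<le> measure (mvnormal m (matrix_inv V)) (cball 0 (4 * r))"
proof -
  interpret N: prob_space "mvnormal m (matrix_inv V)" by (rule prob_space_mvnormal)
  have "lmin \<le> lmax"
    using lmin_le[of "axis undefined 1"] le_lmax[of "axis undefined 1"] by simp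
  \<comment> \<open>\<open>C \<ge> 3\<close> ensures that a shift of length \<open>3 * r\<close>
    towards the mean does not overshoot it; \<open>4 * lmax \<le> lmin * C\<close> ensures that the
    form at \<open>m\<close> is at least four times its value anywhere in the ball.\<close>
  define C where "C = 3 + 4 * lmax / lmin"
  have C: "C \<ge> 3" "4 * lmax \<le> lmin * C"
    using lmin_pos \<open>lmin \<le> lmax\<close> by (simp_all add: C_def field_simps)
  have "3 * r \<le> C * r" using C r by (intro mult_right_mono) auto
  then have m3: "3 * r \<le> norm m" using m by (simp add: C_def)
  \<comment> \<open>The shift gets length \<open>3 * r\<close>: more than \<open>2 * r\<close>, so
    the two balls are disjoint, and short enough for the translate to stay within
    \<open>4 * r\<close>.\<close>
  define t where "t = 3 * r / norm m"
  have nm: "norm m > 0" using m3 r by linarith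
  have t: "0 < t" "t \<le> 1" using m3 nm r by (simp_all add: t_def)
  define s where "s = t *\<^sub>R m"
  have norm_s: "norm s = 3 * r" using nm r by (simp add: s_def t_def)
  have form_m: "4 * lmax * r\<^sup>2 \<le> m \<bullet> (V *v m)"
  proof -
    have "4 * lmax * r\<^sup>2 \<le> lmin * C * r\<^sup>2" using C by (intro mult_right_mono) auto
    also have "\<dots> \<le> lmin * C\<^sup>2 * r\<^sup>2"
      using C lmin_pos by (intro mult_right_mono mult_left_mono) (auto simp: power2_eq_square)
    also have "\<dots> = lmin * (C * r)\<^sup>2" by (simp add: power_mult_distrib)
    also have "\<dots> \<le> lmin * (norm m)\<^sup>2"
      using m C r lmin_pos by (intro mult_left_mono power_mono) (auto simp: C_def[symmetric])
    finally show ?thesis using lmin_le[of m] by linarith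
  qed
  have closer: "gauss_kernel V (y - m) \<le> gauss_kernel V (y + s - m)" if "norm y \<le> r" for y
  proof -
    let ?q = "\<lambda>x. x \<bullet> (V *v x)"
    have q4: "4 * ?q y \<le> ?q m"
    proof -
      have "lmax * (norm y)\<^sup>2 \<le> lmax * r\<^sup>2"
        using that \<open>lmin \<le> lmax\<close> lmin_pos by (intro mult_left_mono power_mono) auto
      then show ?thesis using le_lmax[of y] form_m by linarith
    qed
    \<comment> \<open>Nonnegativity at \<open>m - 2 y\<close> gives 4 (m . V y) <= q m + 4 q y <= 2
      q m. Hence the bracket in the following difference formula is at most q m - (2 - t) q m, which
      is not positive for \<open>t \<le> 1\<close>.\<close>
    have "0 \<le> ?q (m + (-2) *\<^sub>R y)" by (rule form_nonneg)
    then have "2 * (m \<bullet> (V *v y)) \<le> ?q m"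
      using q4 by (simp add: quadratic_form_add[OF sym] matrix_vector_mult_scaleR del: scaleR_minus_left)
    moreover have "?q (y + s - m) - ?q (y - m) = t * (2 * (m \<bullet> (V *v y)) - (2 - t) * ?q m)"
      using quadratic_form_add[OF sym, of "t *\<^sub>R m" "y - m"]
      by (simp add: s_def algebra_simps matrix_vector_mult_scaleR power2_eq_square)
    moreover have "?q m \<le> (2 - t) * ?q m"
      using mult_right_mono[of 1 "2 - t" "?q m"] t form_nonneg[of m] by simp
    ultimately have "?q (y + s - m) \<le> ?q (y - m)"
      using mult_nonneg_nonpos[of t "2 * (m \<bullet> (V *v y)) - (2 - t) * ?q m"] t by linarith
    then show ?thesis by (simp add: gauss_kernel_def)
  qed
  let ?c = "gauss_const V"
  have [measurable]: "cball s r \<in> sets borel" by simp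
  have "emeasure (mvnormal m (matrix_inv V)) (cball 0 r) \<le>
      (\<integral>\<^sup>+ y. ennreal (gauss_kernel V (y + s - m) / ?c) * indicator (cball s r) (y + s) \<partial>lborel)"
    using gauss_const_pos
    by (subst emeasure_mvnormal)
      (auto intro!: nn_integral_mono ennreal_leI divide_right_mono closer
        simp: dist_norm norm_minus_commute split: split_indicator)
  also have "\<dots> = emeasure (mvnormal m (matrix_inv V)) (cball s r)"
    by (subst nn_integral_lborel_shift[of "\<lambda>y. ennreal (gauss_kernel V (y - m) / ?c) * indicator (cball s r) y"])
      (measurable, simp add: emeasure_mvnormal)
  finally have le: "measure (mvnormal m (matrix_inv V)) (cball 0 r) \<le> measure (mvnormal m (matrix_inv V)) (cball s r)"
    by (simp add: N.emeasure_eq_measure)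
  have disj: "cball 0 r \<inter> cball s r = {}"
  proof -
    have False if "norm y \<le> r" "norm (s - y) \<le> r" for y
      using norm_triangle_ineq[of "s - y" y] that norm_s r by simp
    then show ?thesis by (auto simp: dist_norm)
  qed
  have sub: "cball 0 r \<union> cball s r \<subseteq> cball 0 (4 * r)"
  proof -
    have "norm y \<le> 4 * r" if "norm (s - y) \<le> r" for y
      using norm_triangle_ineq4[of s "s - y"] that norm_s by simp
    then show ?thesis using r by (auto simp: dist_norm)
  qed
  have "measure (mvnormal m (matrix_inv V)) (cball 0 r) + measure (mvnormal m (matrix_inv V)) (cball s r)
      = measure (mvnormal m (matrix_inv V)) (cball 0 r \<union> cball s r)"
    using disj by (subst N.finite_measure_Union) auto
  also have "\<dots> \<le> measure (mvnormal m (matrix_inv V)) (cball 0 (4 * r))"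
    using sub by (intro N.finite_measure_mono) auto
  finally show ?thesis using le by linarith
qed

end

subsection \<open>Outer probabilities and comparison of normalised measures\<close>

context finite_measure
begin

lemma outer_prob_le:
  assumes "B \<in> sets M" "A \<inter> space M \<subseteq> B"
  shows "outer_prob M A \<le> measure M B"
  unfolding outer_prob_def
  by (rule cInf_lower) (use assms in \<open>auto intro!: bdd_belowI[of _ 0]\<close>)

lemma outer_prob_nonneg: "outer_prob M A \<ge> 0"
  unfolding outer_prob_def by (rule cInf_greatest) auto

lemma outer_prob_cover:
  assumes "outer_prob M A < c"
  obtains B where "B \<in> sets M" "A \<inter> space M \<subseteq> B" "measure M B < c"
proof -
  have "{measure M B | B. B \<in> sets M \<and> A \<inter> space M \<subseteq> B} \<noteq> {}"
    using sets.top[of M] by blast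
  from cInf_lessD[OF this assms[unfolded outer_prob_def]] show ?thesis using that by blast
qed

lemma outer_prob_mono:
  assumes "A \<inter> space M \<subseteq> B"
  shows "outer_prob M A \<le> outer_prob M B"
proof (rule field_le_epsilon)
  fix e :: real assume "e > 0"
  then have "outer_prob M B < outer_prob M B + e" by simp
  then obtain C where C: "C \<in> sets M" "B \<inter> space M \<subseteq> C" "measure M C < outer_prob M B + e"
    by (rule outer_prob_cover)
  then have "outer_prob M A \<le> measure M C" using assms by (intro outer_prob_le) auto
  then show "outer_prob M A \<le> outer_prob M B + e" using C by linarith
qed

lemma outer_prob_Un: "outer_prob M (A \<union> B) \<le> outer_prob M A + outer_prob M B"
proof (rule field_le_epsilon)
  fix e :: real assume "e > 0"
  then have "outer_prob M A < outer_prob M A + e / 2" "outer_prob M B < outer_prob M B + e / 2" by auto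
  then obtain C D where C: "C \<in> sets M" "A \<inter> space M \<subseteq> C" "measure M C < outer_prob M A + e / 2"
    and D: "D \<in> sets M" "B \<inter> space M \<subseteq> D" "measure M D < outer_prob M B + e / 2"
    by (metis outer_prob_cover)
  have "outer_prob M (A \<union> B) \<le> measure M (C \<union> D)" using C D by (intro outer_prob_le) auto
  also have "\<dots> \<le> measure M C + measure M D" using C D by (intro measure_Un_le) auto
  finally show "outer_prob M (A \<union> B) \<le> outer_prob M A + outer_prob M B + e" using C D by simp
qed

end

text \<open>If no fixed radius worked, radii growing along a sparse sequence of times would violate the hypothesis.\<close>

lemma diverging_radii_imp_fixed_radius:
  fixes a :: "nat \<Rightarrow> real \<Rightarrow> real"
  assumes lim: "\<And>M :: nat \<Rightarrow> real. mono M \<Longrightarrow> filterlim M at_top sequentially \<Longrightarrow> (\<lambda>n. a n (M n)) \<longlonglongrightarrow> 0"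
    and \<delta>: "\<delta> > 0"
  shows "\<exists>k\<ge>k1. eventually (\<lambda>n. a n (real k) < \<delta>) sequentially"
proof (rule ccontr)
  assume "\<not> ?thesis"
  then have "\<forall>N k. \<exists>n\<ge>N. a n (real (k1 + k)) \<ge> \<delta>"
    by (simp add: eventually_sequentially not_less flip: of_nat_add)
  then obtain g where g: "\<And>N k. g N k \<ge> N" "\<And>N k. a (g N k) (real (k1 + k)) \<ge> \<delta>" by metis
  \<comment> \<open>\<open>r k\<close> is a time at which the radius \<open>k1 + k\<close> fails,
    each chosen later than the one before.\<close>
  define r where "r = rec_nat (g 0 0) (\<lambda>k rk. g (Suc rk) (Suc k))"
  have r: "a (r k) (real (k1 + k)) \<ge> \<delta>" for k
    using g(2)[of 0 0] g(2)[of "Suc (r (k - 1))" k] by (cases k) (simp_all add: r_def)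
  have "r k < r (Suc k)" for k
    using g(1)[of "Suc (r k)" "Suc k"] by (simp add: r_def)
  then have mono_r: "strict_mono r" by (rule strict_mono_Suc_iff[THEN iffD2, rule_format])
  \<comment> \<open>\<open>M\<close> is a step function that counts the failure times passed so far.
    Counting starts at index 1 so that at time \<open>r j\<close> the radius is exactly
    \<open>k1 + j\<close>, the one that fails there.\<close>
  define M where "M n = real (k1 + card {k. 1 \<le> k \<and> r k \<le> n})" for n
  have fin: "finite {k. 1 \<le> k \<and> r k \<le> n}" for n
    by (rule finite_subset[of _ "{..n}"]) (use seq_suble[OF mono_r] in \<open>auto intro: order_trans\<close>)
  have M_mono: "mono M"
    unfolding M_def by (intro monoI of_nat_mono add_left_mono card_mono fin) auto
  have M_r: "M (r j) = real (k1 + j)" for j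
  proof -
    have "{k. 1 \<le> k \<and> r k \<le> r j} = {1..j}" using strict_mono_less_eq[OF mono_r] by auto
    then show ?thesis by (simp add: M_def)
  qed
  have "filterlim M at_top sequentially"
    unfolding filterlim_at_top
  proof
    fix Z :: real
    have "Z \<le> M (r (nat \<lceil>Z\<rceil>))" using real_nat_ceiling_ge[of Z] by (simp add: M_r)
    then show "eventually (\<lambda>n. Z \<le> M n) sequentially"
      unfolding eventually_sequentially using monoD[OF M_mono] order_trans by blast
  qed
  from lim[OF M_mono this] have "eventually (\<lambda>n. a n (M n) < \<delta>) sequentially"
    using \<delta> order_tendstoD(2) by blast
  then obtain n0 where n0: "\<And>n. n \<ge> n0 \<Longrightarrow> a n (M n) < \<delta>" by (auto simp: eventually_sequentially)
  show False using n0[of "r n0"] r[of n0] seq_suble[OF mono_r, of n0] by (simp add: M_r)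
qed

text \<open>Intended reading: \<open>\<nu>\<close> is the unnormalised posterior of the rescaled
  parameter, \<open>\<nu>'\<close> its part with the nuisance parameter in \<open>H n\<close>,
  \<open>N\<close> the normal law, and \<open>K0\<close>, \<open>K\<close> the two balls. Only
  \<open>\<nu>'\<close> on \<open>K\<close> is sandwiched, and only up to an unknown factor
  \<open>c\<close>, which has to disappear by taking ratios.\<close>

locale measure_comparison =
  \<nu>: finite_measure \<nu> + \<nu>': finite_measure \<nu>' + N: prob_space N
  for \<nu> \<nu>' N :: "'a measure" +
  fixes K0 K :: "'a set" and c \<rho> \<delta> :: real
  assumes sets_eq: "sets \<nu>' = sets \<nu>" "sets N = sets \<nu>"
    and K0 [measurable]: "K0 \<in> sets \<nu>" and K [measurable]: "K \<in> sets \<nu>" and K0_K: "K0 \<subseteq> K"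
    and \<nu>'_le: "\<And>B. B \<in> sets \<nu> \<Longrightarrow> measure \<nu>' B \<le> measure \<nu> B"
    and total_pos: "measure \<nu> (space \<nu>) > 0"
    and \<nu>'_total: "(1 - \<delta>) * measure \<nu> (space \<nu>) \<le> measure \<nu>' (space \<nu>)"
    and outside: "measure \<nu> (space \<nu> - K0) \<le> \<delta> * measure \<nu> (space \<nu>)"
    and \<rho>: "\<rho> \<ge> 1" and \<delta>: "\<delta> < 1 / 2"
    and lower: "\<And>B. B \<in> sets \<nu> \<Longrightarrow> B \<subseteq> K \<Longrightarrow> c * measure N B \<le> \<rho> * measure \<nu>' B"
    and upper: "\<And>B. B \<in> sets \<nu> \<Longrightarrow> B \<subseteq> K \<Longrightarrow> measure \<nu>' B \<le> \<rho> * (c * measure N B)"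
begin

lemma space_eq: "space \<nu>' = space \<nu>" "space N = space \<nu>"
  using sets_eq sets_eq_imp_space_eq by blast+

text \<open>One \<open>\<delta>\<close> pays for passing from \<open>\<nu>\<close> to
  \<open>\<nu>'\<close>, the other for the mass outside \<open>K0\<close>.\<close>

lemma \<nu>'_ge:
  assumes [measurable]: "A \<in> sets \<nu>" and "K0 \<subseteq> A"
  shows "(1 - 2 * \<delta>) * measure \<nu> (space \<nu>) \<le> measure \<nu>' A"
proof -
  have "measure \<nu>' (space \<nu>) = measure \<nu>' A + measure \<nu>' (space \<nu> - A)"
    using \<nu>'.finite_measure_compl[of A] by (simp add: sets_eq space_eq)
  moreover have "measure \<nu>' (space \<nu> - A) \<le> measure \<nu> (space \<nu> - A)" by (rule \<nu>'_le) simp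
  moreover have "measure \<nu> (space \<nu> - A) \<le> measure \<nu> (space \<nu> - K0)"
    using assms by (intro \<nu>.finite_measure_mono) auto
  ultimately show ?thesis using \<nu>'_total outside by (simp add: algebra_simps)
qed

lemma \<nu>'_K_pos: "measure \<nu>' K > 0"
  using \<nu>'_ge[OF K K0_K] mult_pos_pos[of "1 - 2 * \<delta>", OF _ total_pos] \<delta> by linarith

lemma cN_pos: "c * measure N K > 0"
  using upper[OF K order_refl] \<nu>'_K_pos \<rho> mult_nonneg_nonpos[of \<rho> "c * measure N K"] by linarith

lemma c_pos: "c > 0" and N_K_pos: "measure N K > 0"
  using cN_pos measure_nonneg[of N K] by (auto simp: zero_less_mult_iff)

text \<open>Carries the concentration of the posterior on \<open>K0\<close> over to \<open>N\<close>
  conditioned on \<open>K\<close>; this is what later locates the mean of the normal law. Using both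
  sides of the sandwich costs one \<open>\<rho>\<close> each.\<close>

lemma reference_mass_K0: "(1 - 2 * \<delta>) * measure N K \<le> \<rho>\<^sup>2 * measure N K0"
proof -
  have "measure \<nu>' K \<le> measure \<nu> (space \<nu>)"
    using \<nu>'_le[OF K] \<nu>.bounded_measure[of K] by linarith
  then have "(1 - 2 * \<delta>) * measure \<nu>' K \<le> (1 - 2 * \<delta>) * measure \<nu> (space \<nu>)"
    using \<delta> by (intro mult_left_mono) auto
  then have "(1 - 2 * \<delta>) * measure \<nu>' K \<le> \<rho> * (c * measure N K0)"
    using \<nu>'_ge[OF K0] upper[OF K0 K0_K] by simp
  moreover have "(1 - 2 * \<delta>) * (c * measure N K) \<le> (1 - 2 * \<delta>) * (\<rho> * measure \<nu>' K)"
    using lower[OF K] \<delta> by (intro mult_left_mono) auto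
  moreover have "\<rho> * ((1 - 2 * \<delta>) * measure \<nu>' K) \<le> \<rho> * (\<rho> * (c * measure N K0))"
    using calculation(1) \<rho> by (intro mult_left_mono) auto
  ultimately have "c * ((1 - 2 * \<delta>) * measure N K) \<le> c * (\<rho>\<^sup>2 * measure N K0)"
    by (simp add: power2_eq_square algebra_simps)
  then show ?thesis using c_pos by simp
qed

text \<open>A triangle inequality through \<open>\<nu>'\<close> conditioned on \<open>K\<close> and
  \<open>N\<close> conditioned on \<open>K\<close>. The three summands of the bound are the costs of
  conditioning \<open>\<nu>\<close>, of the sandwich, and of conditioning \<open>N\<close>.\<close>

lemma normalised_distance:
  assumes B [measurable]: "B \<in> sets \<nu>"
  shows "\<bar>measure \<nu> B / measure \<nu> (space \<nu>) - measure N B\<bar>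
    \<le> 2 * \<delta> + (\<rho>\<^sup>2 - 1) + measure N (space \<nu> - K)"
proof -
  define D where "D = measure \<nu> (space \<nu>)"
  define k where "k = measure \<nu>' K / D"
  define q where "q = measure \<nu>' (B \<inter> K) / measure \<nu>' K"
  define g where "g = measure N (B \<inter> K) / measure N K"
  have D: "D > 0" using total_pos by (simp add: D_def)
  have q01: "0 \<le> q" "q \<le> 1"
    using \<nu>'_K_pos \<nu>'.finite_measure_mono[of "B \<inter> K" K] by (auto simp: q_def sets_eq)
  have g01: "0 \<le> g" "g \<le> 1"
    using N_K_pos N.finite_measure_mono[of "B \<inter> K" K] by (auto simp: g_def sets_eq)
  have k1: "1 - 2 * \<delta> \<le> k" using \<nu>'_ge[OF K K0_K] D by (simp add: k_def D_def pos_le_divide_eq)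
  have split: "measure M A = measure M (A \<inter> K) + measure M (A - K)"
    if "finite_measure M" "sets M = sets \<nu>" "A \<in> sets \<nu>" for M A
    using that finite_measure.finite_measure_Union[of M "A \<inter> K" "A - K"]
    by (simp add: Int_Diff_Un) (metis Diff_Int_distrib2 Diff_disjoint Int_Diff Int_commute K sets.Diff sets.Int)
  have lo: "measure \<nu>' (B \<inter> K) \<le> measure \<nu> B"
    using \<nu>'_le[of "B \<inter> K"] \<nu>.finite_measure_mono[of "B \<inter> K" B] by simp
  \<comment> \<open>Obtained by passing to complements: \<open>\<nu>\<close> gives the complement of
    \<open>B\<close> at least the mass \<open>\<nu>'\<close> gives to \<open>K - B\<close>.\<close>
  have hi: "measure \<nu> B - measure \<nu>' (B \<inter> K) \<le> D - measure \<nu>' K"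
  proof -
    have "measure \<nu> (space \<nu> - B) \<ge> measure \<nu>' (K - B)"
      using \<nu>'_le[of "K - B"] \<nu>.finite_measure_mono[of "K - B" "space \<nu> - B"] sets.sets_into_space[OF K]
      by (meson B Diff_mono K order_refl order_trans sets.Diff sets.top)
    moreover have "measure \<nu>' K = measure \<nu>' (B \<inter> K) + measure \<nu>' (K - B)"
      using \<nu>'.finite_measure_Union[of "B \<inter> K" "K - B"]
      by (simp add: sets_eq disjoint_iff) (metis Int_Diff_Un Int_commute)
    ultimately show ?thesis using \<nu>.finite_measure_compl[of B] by (simp add: D_def)
  qed
  have qk: "measure \<nu>' (B \<inter> K) / D = q * k"
    using \<nu>'_K_pos by (simp add: q_def k_def)
  have 1: "q * k \<le> measure \<nu> B / D" "measure \<nu> B / D \<le> q * k + (1 - k)"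
    using divide_right_mono[OF lo, of D] divide_right_mono[OF hi, of D] D
    unfolding qk[symmetric] unfolding k_def by (simp_all add: diff_divide_distrib)
  have 2: "q - q * (1 - k) \<le> measure \<nu> B / D" "measure \<nu> B / D \<le> q + (1 - q) * (1 - k)"
    using 1 by (simp_all add: algebra_simps)
  have k2: "k \<le> 1"
    using \<nu>'_le[OF K] \<nu>.bounded_measure[of K] D by (simp add: k_def D_def)
  have 3: "q * (1 - k) \<le> 2 * \<delta>" "(1 - q) * (1 - k) \<le> 2 * \<delta>"
    using q01 k1 k2 mult_mono[of q 1 "1 - k" "2 * \<delta>"] mult_mono[of "1 - q" 1 "1 - k" "2 * \<delta>"] by auto
  have i: "\<bar>measure \<nu> B / D - q\<bar> \<le> 2 * \<delta>" using 2 3 by (simp only: abs_le_iff) linarith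
  \<comment> \<open>Multiplying the upper bound on \<open>B \<inter> K\<close> by the lower bound on
    \<open>K\<close> puts \<open>c\<close> on both sides, where it cancels.\<close>
  have u: "q \<le> \<rho>\<^sup>2 * g"
  proof -
    have "measure \<nu>' (B \<inter> K) * (c * measure N K) \<le> (\<rho> * (c * measure N (B \<inter> K))) * (\<rho> * measure \<nu>' K)"
      using cN_pos \<rho> c_pos by (intro mult_mono[OF upper lower]) auto
    then have "c * (measure \<nu>' (B \<inter> K) * measure N K) \<le> c * (\<rho>\<^sup>2 * (measure N (B \<inter> K) * measure \<nu>' K))"
      by (simp add: power2_eq_square algebra_simps)
    then show ?thesis using c_pos N_K_pos \<nu>'_K_pos by (simp add: q_def g_def field_simps)
  qed
  have l: "g \<le> \<rho>\<^sup>2 * q"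
  proof -
    have "(c * measure N (B \<inter> K)) * measure \<nu>' K \<le> (\<rho> * measure \<nu>' (B \<inter> K)) * (\<rho> * (c * measure N K))"
      using \<rho> by (intro mult_mono[OF lower upper]) auto
    then have "c * (measure N (B \<inter> K) * measure \<nu>' K) \<le> c * (\<rho>\<^sup>2 * (measure \<nu>' (B \<inter> K) * measure N K))"
      by (simp add: power2_eq_square algebra_simps)
    then show ?thesis using c_pos N_K_pos \<nu>'_K_pos by (simp add: q_def g_def field_simps)
  qed
  have "(\<rho>\<^sup>2 - 1) * g \<le> \<rho>\<^sup>2 - 1" "(\<rho>\<^sup>2 - 1) * q \<le> \<rho>\<^sup>2 - 1"
    using q01 g01 \<rho> by (simp_all add: mult_left_le)
  then have ii: "\<bar>q - g\<bar> \<le> \<rho>\<^sup>2 - 1" using u l by (simp add: algebra_simps)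
  have NK: "measure N (space \<nu> - K) = 1 - measure N K"
    using N.prob_compl[of K] by (simp add: sets_eq space_eq)
  have "measure N (B - K) \<le> measure N (space \<nu> - K)"
    using sets.sets_into_space[OF B] by (intro N.finite_measure_mono) (auto simp: sets_eq)
  moreover have "measure N B = g * measure N K + measure N (B - K)"
    using split[OF N.finite_measure_axioms sets_eq(2) B] N_K_pos by (simp add: g_def)
  moreover have "0 \<le> g * measure N (space \<nu> - K)" "g * measure N (space \<nu> - K) \<le> measure N (space \<nu> - K)"
    using g01 by (simp_all add: mult_left_le_one_le)
  \<comment> \<open>The difference equals \<open>g * N(outside K) - N(B - K)\<close>, and both terms
    lie between 0 and N(outside K).\<close>
  ultimately have iii: "\<bar>g - measure N B\<bar> \<le> measure N (space \<nu> - K)"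
    using measure_nonneg[of N "B - K"] unfolding NK abs_le_iff right_diff_distrib mult_1_right by linarith
  show ?thesis using i ii iii unfolding D_def by linarith
qed

end

subsection \<open>Posterior mass in a shrinking neighbourhood\<close>

text \<open>\<open>f\<close> is continuous only on \<open>U\<close> and arbitrary elsewhere, so
  measurability is available only after cutting off by the indicator of \<open>A\<close>. The
  cut-off measures agree on all Borel sets, hence so do their integrals.\<close>

lemma nn_integral_local_density:
  fixes P :: "'a::euclidean_space measure"
  assumes P: "sets P = sets borel" and U: "open U" "continuous_on U f"
    and dens: "\<And>A. A \<in> sets borel \<Longrightarrow> A \<subseteq> U \<Longrightarrow> emeasure P A = (\<integral>\<^sup>+ t\<in>A. ennreal (f t) \<partial>lborel)"
    and A: "A \<in> sets borel" "A \<subseteq> U" and G: "G \<in> borel_measurable borel"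
  shows "(\<integral>\<^sup>+ t. indicator A t * G t \<partial>P) = (\<integral>\<^sup>+ t. indicator A t * (ennreal (f t) * G t) \<partial>lborel)"
proof -
  note [measurable] = A(1) G
  have [measurable_cong]: "sets P = sets borel" by (rule P)
  have "(\<lambda>t. indicator A t * (indicator U t *\<^sub>R f t)) \<in> borel_measurable borel"
    using borel_measurable_continuous_on_indicator[of U f] U by (intro borel_measurable_times) auto
  also have "(\<lambda>t. indicator A t * (indicator U t *\<^sub>R f t)) = (\<lambda>t. indicator A t * f t)"
    using A by (auto simp: fun_eq_iff indicator_def)
  finally have "(\<lambda>t. ennreal (indicator A t * f t)) \<in> borel_measurable borel" by simp
  also have "(\<lambda>t. ennreal (indicator A t * f t)) = (\<lambda>t. indicator A t * ennreal (f t))"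
    by (auto simp: fun_eq_iff indicator_def)
  finally have f [measurable]: "(\<lambda>t. indicator A t * ennreal (f t)) \<in> borel_measurable borel" .
  have "density P (indicator A) = density lborel (\<lambda>t. indicator A t * ennreal (f t))"
  proof (rule measure_eqI)
    fix B assume "B \<in> sets (density P (indicator A))"
    then have B [measurable]: "B \<in> sets borel" by (simp add: P)
    have "emeasure (density P (indicator A)) B = emeasure P (A \<inter> B)"
      by (simp add: emeasure_density flip: indicator_inter_arith)
    also have "\<dots> = (\<integral>\<^sup>+ t\<in>A \<inter> B. ennreal (f t) \<partial>lborel)" using A by (intro dens) auto
    also have "\<dots> = (\<integral>\<^sup>+ t. indicator A t * ennreal (f t) * indicator B t \<partial>lborel)"
      by (intro nn_integral_cong) (auto simp: indicator_def)
    also have "\<dots> = emeasure (density lborel (\<lambda>t. indicator A t * ennreal (f t))) B"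
      by (simp add: emeasure_density)
    finally show "emeasure (density P (indicator A)) B = \<dots>" .
  qed (simp add: P)
  then have "(\<integral>\<^sup>+ t. G t \<partial>density P (indicator A)) = (\<integral>\<^sup>+ t. G t \<partial>density lborel (\<lambda>t. indicator A t * ennreal (f t)))"
    by simp
  then show ?thesis by (simp add: nn_integral_density mult.assoc)
qed

lemma nn_integral_pair_product:
  assumes Q: "sigma_finite_measure Q"
    and [measurable]: "F \<in> borel_measurable P" "G \<in> borel_measurable Q"
  shows "(\<integral>\<^sup>+ z. F (fst z) * G (snd z) \<partial>(P \<Otimes>\<^sub>M Q)) = (\<integral>\<^sup>+ t. F t \<partial>P) * (\<integral>\<^sup>+ e. G e \<partial>Q)"
proof -
  interpret Q: sigma_finite_measure Q by (rule Q)
  have "(\<integral>\<^sup>+ z. F (fst z) * G (snd z) \<partial>(P \<Otimes>\<^sub>M Q)) = (\<integral>\<^sup>+ t. \<integral>\<^sup>+ e. F t * G e \<partial>Q \<partial>P)"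
    using Q.nn_integral_fst[of "\<lambda>z. F (fst z) * G (snd z)" P] by simp
  then show ?thesis by (simp add: nn_integral_cmult nn_integral_multc)
qed

text \<open>Replacing the likelihood by \<open>g h * w0 e\<close> costs \<open>\<rho>1\<close> and
  makes the integral over the product prior factorise. Replacing the prior density by the constant
  \<open>d0\<close> costs \<open>\<rho>2\<close>. The substitution
  \<open>h = s *\<^sub>R (t - t0)\<close> contributes the power of \<open>1 / s\<close>; what does
  not involve \<open>B\<close> is collected in \<open>C\<close>.\<close>

lemma local_mass_bounds:
  fixes P :: "'a::euclidean_space measure" and Q :: "'h::topological_space measure"
    and w :: "'a \<Rightarrow> 'h \<Rightarrow> real" and g :: "'a \<Rightarrow> real" and w0 :: "'h \<Rightarrow> real"
  assumes P: "sets P = sets borel" and Q: "prob_space Q" "sets Q = sets borel"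
    and U: "open U" "continuous_on U f"
    and dens: "\<And>A. A \<in> sets borel \<Longrightarrow> A \<subseteq> U \<Longrightarrow> emeasure P A = (\<integral>\<^sup>+ t\<in>A. ennreal (f t) \<partial>lborel)"
    and H: "H \<in> sets borel" and B: "B \<in> sets borel" and s: "s > 0"
    and w: "(\<lambda>z. w (fst z) (snd z)) \<in> borel_measurable (borel \<Otimes>\<^sub>M borel)" "\<And>t e. w t e \<ge> 0"
    and g: "g \<in> borel_measurable borel" "\<And>h. g h \<ge> 0"
    and w0: "w0 \<in> borel_measurable borel" "\<And>e. w0 e \<ge> 0"
    and pos: "\<rho>1 > 0" "\<rho>2 > 0" "d0 \<ge> 0"
    and f: "\<And>h. h \<in> B \<Longrightarrow> t0 + (1 / s) *\<^sub>R h \<in> U"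
      "\<And>h. h \<in> B \<Longrightarrow> d0 \<le> \<rho>2 * f (t0 + (1 / s) *\<^sub>R h)"
      "\<And>h. h \<in> B \<Longrightarrow> f (t0 + (1 / s) *\<^sub>R h) \<le> \<rho>2 * d0"
    and wg: "\<And>h e. h \<in> B \<Longrightarrow> e \<in> H \<Longrightarrow> g h * w0 e \<le> \<rho>1 * w (t0 + (1 / s) *\<^sub>R h) e"
      "\<And>h e. h \<in> B \<Longrightarrow> e \<in> H \<Longrightarrow> w (t0 + (1 / s) *\<^sub>R h) e \<le> \<rho>1 * (g h * w0 e)"
  defines "I \<equiv> \<integral>\<^sup>+ z. indicator B (s *\<^sub>R (fst z - t0)) * indicator H (snd z) * ennreal (w (fst z) (snd z)) \<partial>(P \<Otimes>\<^sub>M Q)"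
    and "C \<equiv> ennreal ((1 / s) ^ DIM('a) * d0) * (\<integral>\<^sup>+ e. indicator H e * ennreal (w0 e) \<partial>Q)"
  shows "I \<le> ennreal (\<rho>1 * \<rho>2) * (C * (\<integral>\<^sup>+ h. indicator B h * ennreal (g h) \<partial>lborel))"
    and "C * (\<integral>\<^sup>+ h. indicator B h * ennreal (g h) \<partial>lborel) \<le> ennreal (\<rho>1 * \<rho>2) * I"
proof -
  interpret Q: prob_space Q by (rule Q)
  have cong [measurable_cong]: "sets P = sets borel" "sets Q = sets borel" by (rule P Q)+
  have [measurable_cong]: "sets (P \<Otimes>\<^sub>M Q) = sets (borel \<Otimes>\<^sub>M borel)"
    by (intro sets_pair_measure_cong cong)
  note [measurable] = H B w(1) g(1) w0(1)
  define \<phi> where "\<phi> t = s *\<^sub>R (t - t0)" for t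
  have [measurable]: "\<phi> \<in> borel_measurable borel" by (simp add: \<phi>_def[abs_def])
  have inv: "t0 + (1 / s) *\<^sub>R \<phi> t = t" "\<phi> (t0 + (1 / s) *\<^sub>R h) = h" for t h
    using s by (simp_all add: \<phi>_def)
  define T where "T = (\<integral>\<^sup>+ t. indicator B (\<phi> t) * ennreal (g (\<phi> t)) \<partial>P)"
  define W where "W = (\<integral>\<^sup>+ e. indicator H e * ennreal (w0 e) \<partial>Q)"
  define G where "G = (\<integral>\<^sup>+ h. indicator B h * ennreal (g h) \<partial>lborel)"
  have I: "I = (\<integral>\<^sup>+ z. indicator B (\<phi> (fst z)) * indicator H (snd z) * ennreal (w (fst z) (snd z)) \<partial>(P \<Otimes>\<^sub>M Q))"
    by (simp add: I_def \<phi>_def)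
  have TW: "T * W = (\<integral>\<^sup>+ z. indicator B (\<phi> (fst z)) * ennreal (g (\<phi> (fst z))) * (indicator H (snd z) * ennreal (w0 (snd z))) \<partial>(P \<Otimes>\<^sub>M Q))"
    unfolding T_def W_def by (rule nn_integral_pair_product[symmetric]) (auto intro: Q.sigma_finite_measure_axioms)
  have "I \<le> (\<integral>\<^sup>+ z. ennreal \<rho>1 * (indicator B (\<phi> (fst z)) * ennreal (g (\<phi> (fst z))) * (indicator H (snd z) * ennreal (w0 (snd z)))) \<partial>(P \<Otimes>\<^sub>M Q))"
    unfolding I
  proof (intro nn_integral_mono)
    fix z
    show "indicator B (\<phi> (fst z)) * indicator H (snd z) * ennreal (w (fst z) (snd z)) \<le>
      ennreal \<rho>1 * (indicator B (\<phi> (fst z)) * ennreal (g (\<phi> (fst z))) * (indicator H (snd z) * ennreal (w0 (snd z))))"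
      using wg(2)[of "\<phi> (fst z)" "snd z"] g(2) w0(2) pos
      by (auto simp: inv indicator_def ennreal_leI simp flip: ennreal_mult)
  qed
  then have I1: "I \<le> ennreal \<rho>1 * (T * W)"
    unfolding TW by (subst (asm) nn_integral_cmult) simp_all
  have "T * W \<le> (\<integral>\<^sup>+ z. ennreal \<rho>1 * (indicator B (\<phi> (fst z)) * indicator H (snd z) * ennreal (w (fst z) (snd z))) \<partial>(P \<Otimes>\<^sub>M Q))"
    unfolding TW
  proof (intro nn_integral_mono)
    fix z
    show "indicator B (\<phi> (fst z)) * ennreal (g (\<phi> (fst z))) * (indicator H (snd z) * ennreal (w0 (snd z))) \<le>
      ennreal \<rho>1 * (indicator B (\<phi> (fst z)) * indicator H (snd z) * ennreal (w (fst z) (snd z)))"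
      using wg(1)[of "\<phi> (fst z)" "snd z"] g(2) w0(2) pos w(2)
      by (auto simp: inv indicator_def ennreal_leI simp flip: ennreal_mult)
  qed
  then have I2: "T * W \<le> ennreal \<rho>1 * I"
    unfolding I by (subst (asm) nn_integral_cmult) simp_all
  define F where "F h = indicator B h * (ennreal (f (t0 + (1 / s) *\<^sub>R h)) * ennreal (g h))" for h
  define A where "A = \<phi> -` B"
  have A [measurable]: "A \<in> sets borel" and AU: "A \<subseteq> U"
    using measurable_sets[of \<phi> borel borel B] f(1) inv(1) by (auto simp: A_def) metis
  have "(\<lambda>t. indicator A t * (indicator U t *\<^sub>R f t)) \<in> borel_measurable borel"
    using borel_measurable_continuous_on_indicator[of U f] U by (intro borel_measurable_times) auto
  then have "(\<lambda>t. ennreal (indicator A t * (indicator U t *\<^sub>R f t)) * ennreal (g (\<phi> t))) \<in> borel_measurable borel"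
    by measurable
  also have "(\<lambda>t. ennreal (indicator A t * (indicator U t *\<^sub>R f t)) * ennreal (g (\<phi> t)))
      = (\<lambda>t. indicator A t * (ennreal (f t) * ennreal (g (\<phi> t))))"
    using AU by (auto simp: fun_eq_iff indicator_def)
  finally have fA: "(\<lambda>t. indicator A t * (ennreal (f t) * ennreal (g (\<phi> t)))) \<in> borel_measurable borel" .
  have F_eq: "F = (\<lambda>h. indicator A (t0 + (1 / s) *\<^sub>R h) * (ennreal (f (t0 + (1 / s) *\<^sub>R h)) * ennreal (g (\<phi> (t0 + (1 / s) *\<^sub>R h)))))"
    by (auto simp: F_def[abs_def] inv A_def indicator_def)
  have [measurable]: "F \<in> borel_measurable borel"
    unfolding F_eq by (rule measurable_compose[OF _ fA]) simp
  have "T = (\<integral>\<^sup>+ t. indicator A t * ennreal (g (\<phi> t)) \<partial>P)"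
    unfolding T_def by (intro nn_integral_cong) (auto simp: A_def indicator_def)
  also have "\<dots> = (\<integral>\<^sup>+ t. indicator A t * (ennreal (f t) * ennreal (g (\<phi> t))) \<partial>lborel)"
    by (rule nn_integral_local_density[OF P U dens A AU]) simp_all
  also have "\<dots> = ennreal ((1 / s) ^ DIM('a)) * (\<integral>\<^sup>+ h. F h \<partial>lborel)"
    using s by (subst nn_integral_lborel_affine[OF fA, where c="1 / s" and t=t0]) (simp_all add: F_eq)
  finally have T: "T = ennreal ((1 / s) ^ DIM('a)) * (\<integral>\<^sup>+ h. F h \<partial>lborel)" .
  have "(\<integral>\<^sup>+ h. F h \<partial>lborel) \<le> (\<integral>\<^sup>+ h. ennreal (\<rho>2 * d0) * (indicator B h * ennreal (g h)) \<partial>lborel)"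
    using f(3) by (intro nn_integral_mono)
      (auto simp: F_def indicator_def intro!: mult_right_mono ennreal_leI)
  then have F1: "(\<integral>\<^sup>+ h. F h \<partial>lborel) \<le> ennreal (\<rho>2 * d0) * G"
    unfolding G_def by (subst (asm) nn_integral_cmult) simp_all
  have "ennreal d0 * G = (\<integral>\<^sup>+ h. ennreal d0 * (indicator B h * ennreal (g h)) \<partial>lborel)"
    unfolding G_def by (subst nn_integral_cmult) simp_all
  also have "\<dots> \<le> (\<integral>\<^sup>+ h. ennreal \<rho>2 * F h \<partial>lborel)"
  proof (intro nn_integral_mono)
    fix h
    show "ennreal d0 * (indicator B h * ennreal (g h)) \<le> ennreal \<rho>2 * F h"
    proof (cases "h \<in> B")
      case True
      then have "ennreal d0 \<le> ennreal \<rho>2 * ennreal (f (t0 + (1 / s) *\<^sub>R h))"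
        using f(2)[OF True] pos by (simp add: ennreal_leI flip: ennreal_mult')
      then show ?thesis using True by (simp add: F_def mult_right_mono flip: mult.assoc)
    qed simp
  qed
  finally have "ennreal d0 * G \<le> (\<integral>\<^sup>+ h. ennreal \<rho>2 * F h \<partial>lborel)" .
  moreover have "(\<integral>\<^sup>+ h. ennreal \<rho>2 * F h \<partial>lborel) = ennreal \<rho>2 * (\<integral>\<^sup>+ h. F h \<partial>lborel)"
    by (rule nn_integral_cmult) simp
  ultimately have F2: "ennreal d0 * G \<le> ennreal \<rho>2 * (\<integral>\<^sup>+ h. F h \<partial>lborel)" by simp
  have CG: "C * G = ennreal ((1 / s) ^ DIM('a)) * (ennreal d0 * G) * W"
    using s pos by (simp add: C_def W_def ennreal_mult ac_simps)
  have "T * W \<le> ennreal ((1 / s) ^ DIM('a)) * (ennreal (\<rho>2 * d0) * G) * W"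
    unfolding T using F1 by (intro mult_right_mono mult_left_mono) auto
  also have "\<dots> = ennreal \<rho>2 * (C * G)"
    using pos by (simp add: CG ennreal_mult ac_simps)
  finally have "I \<le> ennreal \<rho>1 * (ennreal \<rho>2 * (C * G))"
    using I1 by (meson mult_left_mono order_trans zero_le)
  then show "I \<le> ennreal (\<rho>1 * \<rho>2) * (C * (\<integral>\<^sup>+ h. indicator B h * ennreal (g h) \<partial>lborel))"
    using pos by (simp add: G_def ennreal_mult mult.assoc)
  have "C * G \<le> ennreal ((1 / s) ^ DIM('a)) * (ennreal \<rho>2 * (\<integral>\<^sup>+ h. F h \<partial>lborel)) * W"
    unfolding CG using F2 by (intro mult_right_mono mult_left_mono) auto
  also have "\<dots> = ennreal \<rho>2 * (T * W)" by (simp add: T ac_simps)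
  also have "\<dots> \<le> ennreal \<rho>2 * (ennreal \<rho>1 * I)" using I2 by (intro mult_left_mono) auto
  finally show "C * (\<integral>\<^sup>+ h. indicator B h * ennreal (g h) \<partial>lborel) \<le> ennreal (\<rho>1 * \<rho>2) * I"
    using pos by (simp add: G_def ennreal_mult ac_simps)
qed

section \<open>The normal approximation for one fixed observation\<close>

context pos_def_form
begin

lemma complete_square:
  assumes "m = matrix_inv V *v l"
  shows "exp (h \<bullet> l - h \<bullet> (V *v h) / 2) = exp (m \<bullet> (V *v m) / 2) * gauss_kernel V (h - m)"
proof -
  have Vm: "V *v m = l"
    by (simp add: assms matrix_vector_mul_assoc matrix_inv_inverse[OF invertible])
  have "h \<bullet> l = (h - m) \<bullet> (V *v m) + m \<bullet> (V *v m)" by (simp add: Vm inner_diff_left)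
  moreover have "h \<bullet> (V *v h) = (h - m) \<bullet> (V *v (h - m)) + 2 * ((h - m) \<bullet> (V *v m)) + m \<bullet> (V *v m)"
    using quadratic_form_add[OF sym, of "h - m" m] by simp
  ultimately show ?thesis by (simp add: gauss_kernel_def field_simps flip: exp_add)
qed

lemma nn_integral_local_likelihood:
  assumes m: "m = matrix_inv V *v l" and [measurable]: "B \<in> sets borel"
  shows "(\<integral>\<^sup>+ h. indicator B h * ennreal (exp (h \<bullet> l - h \<bullet> (V *v h) / 2)) \<partial>lborel) =
    ennreal (exp (m \<bullet> (V *v m) / 2) * gauss_const V) * emeasure (mvnormal m (matrix_inv V)) B"
proof -
  let ?k = "exp (m \<bullet> (V *v m) / 2) * gauss_const V"
  have "indicator B h * ennreal (exp (h \<bullet> l - h \<bullet> (V *v h) / 2)) =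
      ennreal ?k * (ennreal (gauss_kernel V (h - m) / gauss_const V) * indicator B h)" for h
    using gauss_const_pos
    by (simp add: complete_square[OF m] indicator_def flip: ennreal_mult'')
  then show ?thesis by (simp add: emeasure_mvnormal nn_integral_cmult)
qed

text \<open>Needed to rule out an infinite comparison constant: a positive normal mass times an
  infinite constant could not be bounded by a finite posterior mass.\<close>

lemma mvnormal_ball_pos:
  assumes "M > 0"
  shows "measure (mvnormal m (matrix_inv V)) (cball 0 M) > 0"
proof -
  interpret N: prob_space "mvnormal m (matrix_inv V)" by (rule prob_space_mvnormal)
  have "measure (mvnormal m (matrix_inv V)) (cball 0 M) \<noteq> 0"
  proof
    assume "measure (mvnormal m (matrix_inv V)) (cball 0 M) = 0"
    then have "cball 0 M \<in> null_sets (mvnormal m (matrix_inv V))"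
      by (intro null_setsI) (simp_all add: N.emeasure_eq_measure)
    then have "AE y in lborel. y \<in> cball 0 M \<longrightarrow> ennreal (gauss_kernel V (y - m) / gauss_const V) = 0"
      unfolding mvnormal_eq by (subst (asm) null_sets_density_iff) auto
    then have "AE y in lborel. (y :: real ^ 'p) \<notin> cball 0 M"
    proof eventually_elim
      case (elim y)
      have "gauss_kernel V (y - m) / gauss_const V > 0" by (intro divide_pos_pos gauss_const_pos gauss_kernel_pos)
      then show ?case using elim by auto
    qed
    then have "emeasure lborel (cball (0 :: real ^ 'p) M) = 0"
      by (subst (asm) AE_iff_measurable[OF _ refl]) (auto simp: cball_def)
    then show False using assms unit_ball_vol_pos[of "real CARD('p)"] by (simp add: emeasure_cball)
  qed
  then show ?thesis using measure_nonneg[of "mvnormal m (matrix_inv V)" "cball 0 M"] by linarith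
qed

text \<open>On the log scale there are three errors of size \<open>\<eta>\<close>: the LAN
  remainder, the replacement of the score \<open>le\<close> by \<open>l\<close>, and that of the
  matrix \<open>Ve\<close> by \<open>V\<close>. The last two are linear and quadratic in
  \<open>h\<close>, which explains the factors \<open>M\<close> and \<open>M\<^sup>2 / 2\<close> in
  the hypotheses.\<close>

lemma local_likelihood_bounds:
  fixes w w0 s M \<eta> :: real
  assumes w: "w > 0" "w0 > 0"
    and lan: "\<bar>ln (w / w0) - (h \<bullet> le) / s + (h \<bullet> (Ve *v h)) / 2\<bar> \<le> \<eta>"
    and s: "s > 0" and h: "norm h \<le> M"
    and le: "norm (le - l) \<le> \<eta>1 * s" "\<eta>1 * M \<le> \<eta>"
    and Ve: "onorm (\<lambda>v. (Ve - V) *v v) \<le> \<eta>2" "\<eta>2 * M\<^sup>2 / 2 \<le> \<eta>"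
  defines "L \<equiv> exp (h \<bullet> ((1 / s) *\<^sub>R l) - h \<bullet> (V *v h) / 2)"
  shows "w \<le> exp (3 * \<eta>) * (L * w0)" "L * w0 \<le> exp (3 * \<eta>) * w"
proof -
  have M: "M \<ge> 0" using h norm_ge_zero[of h] by linarith
  have "\<bar>h \<bullet> (le - l)\<bar> \<le> norm h * norm (le - l)" by (rule Cauchy_Schwarz_ineq2)
  also have "\<dots> \<le> M * (\<eta>1 * s)" using h le M by (intro mult_mono) auto
  also have "\<dots> \<le> \<eta> * s" using mult_right_mono[OF le(2), of s] s by (simp add: ac_simps)
  finally have "\<bar>h \<bullet> (le - l)\<bar> / s \<le> \<eta>" using s by (simp add: pos_divide_le_eq)
  then have 1: "\<bar>(h \<bullet> le) / s - (h \<bullet> l) / s\<bar> \<le> \<eta>"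
    using s by (simp add: inner_diff_right abs_divide flip: diff_divide_distrib)
  have "\<bar>h \<bullet> ((Ve - V) *v h)\<bar> \<le> norm h * norm ((Ve - V) *v h)" by (rule Cauchy_Schwarz_ineq2)
  also have "\<dots> \<le> norm h * (onorm (\<lambda>v. (Ve - V) *v v) * norm h)"
    by (intro mult_left_mono onorm matrix_vector_mul_bounded_linear) auto
  also have "\<dots> \<le> \<eta>2 * (norm h)\<^sup>2"
    using mult_right_mono[OF Ve(1), of "(norm h)\<^sup>2"] by (simp add: power2_eq_square ac_simps)
  also have "\<dots> \<le> \<eta>2 * M\<^sup>2"
  proof -
    have "0 \<le> onorm (\<lambda>v. (Ve - V) *v v)" by (rule onorm_pos_le) (rule matrix_vector_mul_bounded_linear)
    then show ?thesis using Ve h by (intro mult_left_mono power_mono) auto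
  qed
  finally have 2: "\<bar>(h \<bullet> (Ve *v h)) / 2 - (h \<bullet> (V *v h)) / 2\<bar> \<le> \<eta>"
    using Ve(2) by (simp add: matrix_vector_mult_diff_rdistrib inner_diff_right)
  have L: "ln L = (h \<bullet> l) / s - (h \<bullet> (V *v h)) / 2" by (simp add: L_def)
  have "\<bar>ln (w / w0) - ln L\<bar> \<le> 3 * \<eta>" using lan 1 2 unfolding L by linarith
  moreover have "L > 0" by (simp add: L_def)
  ultimately have *: "ln w \<le> ln (exp (3 * \<eta>) * (L * w0))" "ln (L * w0) \<le> ln (exp (3 * \<eta>) * w)"
    using w by (auto simp: ln_div ln_mult)
  show "w \<le> exp (3 * \<eta>) * (L * w0)" "L * w0 \<le> exp (3 * \<eta>) * w"
    using * w \<open>L > 0\<close> by (simp_all del: ln_mult add: ln_le_cancel_iff)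
qed

text \<open>The deterministic core: \<open>w\<close> is the likelihood at one observation outside
  all exceptional events. Nothing is assumed about the size of \<open>m\<close>; its bound is
  derived inside the proof.\<close>

lemma posterior_normal_distance:
  fixes P :: "(real ^ 'p) measure" and Q :: "'h::topological_space measure"
    and w :: "real ^ 'p \<Rightarrow> 'h \<Rightarrow> real" and t0 l :: "real ^ 'p" and M0 s d0 \<delta> \<rho>1 \<rho>2 :: real
  assumes P: "prob_space P" "sets P = sets borel" and Q: "prob_space Q" "sets Q = sets borel"
    and U: "open U" "continuous_on U f"
    and dens: "\<And>A. A \<in> sets borel \<Longrightarrow> A \<subseteq> U \<Longrightarrow> emeasure P A = (\<integral>\<^sup>+ t\<in>A. ennreal (f t) \<partial>lborel)"
    and H: "H \<in> sets borel" and s: "s > 0"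
    and w: "(\<lambda>z. w (fst z) (snd z)) \<in> borel_measurable (borel \<Otimes>\<^sub>M borel)" "\<And>t e. w t e \<ge> 0"
  defines "post \<equiv> \<lambda>A. enn2real (\<integral>\<^sup>+ z. indicator A z * ennreal (w (fst z) (snd z)) \<partial>(P \<Otimes>\<^sub>M Q))
       / enn2real (\<integral>\<^sup>+ z. ennreal (w (fst z) (snd z)) \<partial>(P \<Otimes>\<^sub>M Q))"
  defines "M \<equiv> 2 * (3 + 4 * lmax / lmin) * M0"
  defines "m \<equiv> matrix_inv V *v l"
  assumes finite_total: "(\<integral>\<^sup>+ z. ennreal (w (fst z) (snd z)) \<partial>(P \<Otimes>\<^sub>M Q)) \<noteq> \<top>"
    and post_H: "1 - \<delta> \<le> post {z. snd z \<in> H}"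
    and post_M0: "post {z. s * norm (fst z - t0) > M0} \<le> \<delta>"
    and M0: "M0 > 0" and \<delta>: "\<delta> \<le> 1 / 8"
    and \<rho>: "\<rho>1 > 0" "\<rho>2 > 0" "\<rho>1 * \<rho>2 \<ge> 1" "(\<rho>1 * \<rho>2)\<^sup>2 \<le> 9 / 8" and d0: "d0 \<ge> 0"
    and f: "\<And>h. norm h \<le> M \<Longrightarrow> t0 + (1 / s) *\<^sub>R h \<in> U"
      "\<And>h. norm h \<le> M \<Longrightarrow> d0 \<le> \<rho>2 * f (t0 + (1 / s) *\<^sub>R h)"
      "\<And>h. norm h \<le> M \<Longrightarrow> f (t0 + (1 / s) *\<^sub>R h) \<le> \<rho>2 * d0"
    and wg: "\<And>h e. norm h \<le> M \<Longrightarrow> e \<in> H \<Longrightarrow>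
        exp (h \<bullet> l - h \<bullet> (V *v h) / 2) * w t0 e \<le> \<rho>1 * w (t0 + (1 / s) *\<^sub>R h) e"
      "\<And>h e. norm h \<le> M \<Longrightarrow> e \<in> H \<Longrightarrow>
        w (t0 + (1 / s) *\<^sub>R h) e \<le> \<rho>1 * (exp (h \<bullet> l - h \<bullet> (V *v h) / 2) * w t0 e)"
    and B: "B \<in> sets borel"
  shows "\<bar>post {z. s *\<^sub>R (fst z - t0) \<in> B} - measure (mvnormal m (matrix_inv V)) B\<bar>
    \<le> 2 * \<delta> + ((\<rho>1 * \<rho>2)\<^sup>2 - 1) + sqrt 2 ^ CARD('p) * exp (- lmin * M\<^sup>2 / 16)"
proof -
  interpret P: prob_space P by (rule P)
  interpret Q: prob_space Q by (rule Q)
  interpret N: prob_space "mvnormal m (matrix_inv V)" by (rule prob_space_mvnormal)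
  have "lmin \<le> lmax"
    using lmin_le[of "axis undefined 1"] le_lmax[of "axis undefined 1"] by simp
  then have C0: "3 + 4 * lmax / lmin \<ge> 3" using lmin_pos by simp
  have M: "M > 0" "4 * M0 \<le> M"
    using C0 M0 mult_right_mono[OF C0, of "2 * M0"] by (simp_all add: M_def)
  have cong [measurable_cong]: "sets P = sets borel" "sets Q = sets borel" by (rule P Q)+
  have [measurable_cong]: "sets (P \<Otimes>\<^sub>M Q) = sets (borel \<Otimes>\<^sub>M borel)"
    by (intro sets_pair_measure_cong cong)
  have space_PQ: "space (P \<Otimes>\<^sub>M Q) = UNIV"
    using sets_eq_imp_space_eq[OF cong(1)] sets_eq_imp_space_eq[OF cong(2)] by (simp add: space_pair_measure)
  note [measurable] = H w(1)
  define \<phi> where "\<phi> z = s *\<^sub>R (fst z - t0)" for z :: "(real ^ 'p) \<times> 'h"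
  have [measurable]: "\<phi> \<in> (borel \<Otimes>\<^sub>M borel) \<rightarrow>\<^sub>M borel" unfolding \<phi>_def[abs_def] by measurable
  define W where "W z = ennreal (w (fst z) (snd z))" for z
  have [measurable]: "W \<in> borel_measurable (borel \<Otimes>\<^sub>M borel)" unfolding W_def[abs_def] by measurable
  \<comment> \<open>The unnormalised posterior transported to the local parameter \<open>h\<close>;
    the \<open>\<nu>'\<close> that follows also restricts the nuisance parameter to
    \<open>H\<close>.\<close>
  define \<nu> where "\<nu> = distr (density (P \<Otimes>\<^sub>M Q) W) borel \<phi>"
  define \<nu>' where "\<nu>' = distr (density (P \<Otimes>\<^sub>M Q) (\<lambda>z. indicator H (snd z) * W z)) borel \<phi>"
  define D where "D = (\<integral>\<^sup>+ z. W z \<partial>(P \<Otimes>\<^sub>M Q))"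
  have D_fin: "D \<noteq> \<top>" using finite_total by (simp add: D_def W_def)
  have post: "post A = enn2real (\<integral>\<^sup>+ z. indicator A z * W z \<partial>(P \<Otimes>\<^sub>M Q)) / enn2real D" for A
    by (simp add: post_def D_def W_def)
  have em_\<nu>: "emeasure \<nu> A = (\<integral>\<^sup>+ z. indicator A (\<phi> z) * W z \<partial>(P \<Otimes>\<^sub>M Q))" if "A \<in> sets borel" for A
  proof -
    note [measurable] = that
    have "emeasure \<nu> A = (\<integral>\<^sup>+ y. indicator A y \<partial>\<nu>)" using that by (simp add: \<nu>_def)
    then show ?thesis by (simp add: \<nu>_def nn_integral_distr nn_integral_density ac_simps del: nn_integral_indicator)
  qed
  have em_\<nu>': "emeasure \<nu>' A = (\<integral>\<^sup>+ z. indicator A (\<phi> z) * indicator H (snd z) * W z \<partial>(P \<Otimes>\<^sub>M Q))" if "A \<in> sets borel" for A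
  proof -
    note [measurable] = that
    have "emeasure \<nu>' A = (\<integral>\<^sup>+ y. indicator A y \<partial>\<nu>')" using that by (simp add: \<nu>'_def)
    then show ?thesis by (simp add: \<nu>'_def nn_integral_distr nn_integral_density ac_simps del: nn_integral_indicator)
  qed
  have sets_\<nu> [simp]: "sets \<nu> = sets borel" "sets \<nu>' = sets borel" "space \<nu> = UNIV" "space \<nu>' = UNIV"
    by (simp_all add: \<nu>_def \<nu>'_def)
  have total: "emeasure \<nu> UNIV = D" by (simp add: em_\<nu> D_def)
  have le: "emeasure \<nu>' A \<le> emeasure \<nu> A" if "A \<in> sets borel" for A
    unfolding em_\<nu>[OF that] em_\<nu>'[OF that] by (intro nn_integral_mono) (auto simp: indicator_def)
  interpret \<nu>: finite_measure \<nu> by (rule finite_measureI) (use total D_fin in simp)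
  interpret \<nu>': finite_measure \<nu>'
    by (rule finite_measureI) (use le[of UNIV] total D_fin in \<open>auto simp: top_unique\<close>)
  have post_\<nu>: "post {z. \<phi> z \<in> A} = measure \<nu> A / measure \<nu> UNIV" if "A \<in> sets borel" for A
    unfolding post measure_def em_\<nu>[OF that] total by (simp add: indicator_def)
  have "post {z. snd z \<in> H} = measure \<nu>' UNIV / measure \<nu> UNIV"
    unfolding post measure_def em_\<nu>'[of UNIV, simplified] total by (simp add: indicator_def)
  then have H_mass: "1 - \<delta> \<le> measure \<nu>' UNIV / measure \<nu> UNIV" using post_H by simp
  \<comment> \<open>Division by zero yields 0, so a posterior mass of at least
    \<open>1 - \<delta> > 0\<close> excludes a vanishing evidence.\<close>
  have "measure \<nu> UNIV \<noteq> 0" using H_mass \<delta> by auto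
  then have \<nu>_pos: "measure \<nu> UNIV > 0" using measure_nonneg[of \<nu> UNIV] by linarith
  have "{z. s * norm (fst z - t0) > M0} = {z. \<phi> z \<in> UNIV - cball 0 M0}"
    using s by (auto simp: \<phi>_def)
  then have out_mass: "measure \<nu> (UNIV - cball 0 M0) / measure \<nu> UNIV \<le> \<delta>"
    using post_M0 post_\<nu>[of "UNIV - cball 0 M0"] by simp
  define \<kappa> where "\<kappa> = exp (m \<bullet> (V *v m) / 2) * gauss_const V"
  have \<kappa>: "\<kappa> > 0" using gauss_const_pos by (simp add: \<kappa>_def)
  define C where "C = ennreal ((1 / s) ^ DIM(real ^ 'p) * d0) * (\<integral>\<^sup>+ e. indicator H e * ennreal (w t0 e) \<partial>Q)"
  have w0: "w t0 \<in> borel_measurable borel"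
    using measurable_compose[OF _ w(1), of "\<lambda>e. (t0, e)" borel] by simp
  have L_meas: "(\<lambda>h. exp (h \<bullet> l - h \<bullet> (V *v h) / 2)) \<in> borel_measurable borel"
    by (intro borel_measurable_continuous_onI continuous_intros
        linear_continuous_on matrix_vector_mul_bounded_linear) auto
  have bounds: "emeasure \<nu>' A \<le> ennreal (\<rho>1 * \<rho>2) * (C * ennreal \<kappa> * emeasure (mvnormal m (matrix_inv V)) A)"
    "C * ennreal \<kappa> * emeasure (mvnormal m (matrix_inv V)) A \<le> ennreal (\<rho>1 * \<rho>2) * emeasure \<nu>' A"
    if A: "A \<in> sets borel" "A \<subseteq> cball 0 M" for A
  proof -
    have in_M: "norm h \<le> M" if "h \<in> A" for h using A(2) that by auto
    note b = local_mass_bounds[OF P(2) Q U dens H A(1) s w L_meas exp_ge_zero w0 w(2) \<rho>(1,2) d0,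
        OF _ _ f(1) f(2) f(3) wg(1) wg(2), OF _ _ in_M in_M in_M in_M _ in_M]
    have L: "(\<integral>\<^sup>+ h. indicator A h * ennreal (exp (h \<bullet> l - h \<bullet> (V *v h) / 2)) \<partial>lborel) =
      ennreal \<kappa> * emeasure (mvnormal m (matrix_inv V)) A"
      unfolding \<kappa>_def by (rule nn_integral_local_likelihood[OF _ A(1)]) (simp add: m_def)
    show "emeasure \<nu>' A \<le> ennreal (\<rho>1 * \<rho>2) * (C * ennreal \<kappa> * emeasure (mvnormal m (matrix_inv V)) A)"
      using b(1) unfolding L C_def[symmetric] by (simp add: em_\<nu>'[OF A(1)] W_def \<phi>_def mult.assoc)
    show "C * ennreal \<kappa> * emeasure (mvnormal m (matrix_inv V)) A \<le> ennreal (\<rho>1 * \<rho>2) * emeasure \<nu>' A"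
      using b(2) unfolding L C_def[symmetric] by (simp add: em_\<nu>'[OF A(1)] W_def \<phi>_def mult.assoc)
  qed
  \<comment> \<open>The integral over \<open>H\<close> inside \<open>C\<close> was not assumed
    finite; its finiteness follows from that of \<open>\<nu>'\<close> and the positive normal mass
    of the ball.\<close>
  have "C * ennreal \<kappa> \<noteq> \<top>"
  proof
    assume "C * ennreal \<kappa> = \<top>"
    then have "\<top> \<le> ennreal (\<rho>1 * \<rho>2) * emeasure \<nu>' (cball 0 M)"
      using bounds(2)[of "cball 0 M"] mvnormal_ball_pos[OF M(1), of m]
      by (simp add: N.emeasure_eq_measure ennreal_top_mult)
    then show False by (simp add: \<nu>'.emeasure_eq_measure top_unique ennreal_mult_eq_top_iff)
  qed
  then obtain c where c: "C * ennreal \<kappa> = ennreal c" "c \<ge> 0" by (cases "C * ennreal \<kappa>") auto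
  interpret measure_comparison \<nu> \<nu>' "mvnormal m (matrix_inv V)" "cball 0 M0" "cball 0 M" c "\<rho>1 * \<rho>2" \<delta>
  proof
    show "measure \<nu>' A \<le> measure \<nu> A" if "A \<in> sets \<nu>" for A
      using le[of A] that by (simp add: \<nu>.emeasure_eq_measure \<nu>'.emeasure_eq_measure)
    show "c * measure (mvnormal m (matrix_inv V)) A \<le> \<rho>1 * \<rho>2 * measure \<nu>' A"
      if "A \<in> sets \<nu>" "A \<subseteq> cball 0 M" for A
      using bounds(2)[of A] that c \<rho>(1,2)
      by (simp add: N.emeasure_eq_measure \<nu>'.emeasure_eq_measure flip: ennreal_mult)
    show "measure \<nu>' A \<le> \<rho>1 * \<rho>2 * (c * measure (mvnormal m (matrix_inv V)) A)"
      if "A \<in> sets \<nu>" "A \<subseteq> cball 0 M" for A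
      using bounds(1)[of A] that c \<rho>(1,2)
      by (simp add: N.emeasure_eq_measure \<nu>'.emeasure_eq_measure flip: ennreal_mult)
    show "cball 0 M0 \<subseteq> cball (0 :: real ^ 'p) M" using M M0 by auto
    show "(1 - \<delta>) * measure \<nu> (space \<nu>) \<le> measure \<nu>' (space \<nu>)"
      using H_mass \<nu>_pos by (simp add: pos_le_divide_eq)
    show "measure \<nu> (space \<nu> - cball 0 M0) \<le> \<delta> * measure \<nu> (space \<nu>)"
      using out_mass \<nu>_pos by (simp add: pos_divide_le_eq)
  qed (use \<nu>_pos \<rho> \<delta> in auto)
  \<comment> \<open>If the mean were farther out, doubling would give N(K0) <= N(K) / 2, hence 3/4
    N(K) <= 9/8 N(K0) <= 9/16 N(K), which is impossible for N(K) > 0.\<close>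
  have "norm m \<le> M / 2"
  proof (rule ccontr)
    assume "\<not> norm m \<le> M / 2"
    then have "norm m \<ge> (3 + 4 * lmax / lmin) * M0"
      unfolding M_def mult.assoc by simp
    from mvnormal_ball_doubling[OF M0 this]
    have 1: "2 * N.prob (cball 0 M0) \<le> N.prob (cball 0 M)"
      using N.finite_measure_mono[OF subset_cball[OF M(2)], of 0] by simp
    have "3 / 4 * N.prob (cball 0 M) \<le> (1 - 2 * \<delta>) * N.prob (cball 0 M)"
      using \<open>\<delta> \<le> 1 / 8\<close> by (intro mult_right_mono) auto
    also note reference_mass_K0
    also have "(\<rho>1 * \<rho>2)\<^sup>2 * N.prob (cball 0 M0) \<le> 9 / 8 * N.prob (cball 0 M0)"
      using \<open>(\<rho>1 * \<rho>2)\<^sup>2 \<le> 9 / 8\<close> by (intro mult_right_mono) auto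
    finally show False using 1 N_K_pos by simp
  qed
  from mvnormal_tail[OF this]
  have "N.prob (space \<nu> - cball 0 M) \<le> sqrt 2 ^ CARD('p) * exp (- lmin * M\<^sup>2 / 16)"
    by (simp add: Compl_eq_Diff_UNIV)
  then show ?thesis
    using normalised_distance[of B] B post_\<nu>[OF B] by (simp add: \<phi>_def)
qed

end

subsection \<open>Measurability of the posterior\<close>

lemma posterior_nonneg: "posterior Prior p n A x \<ge> 0"
  by (simp add: posterior_def)

lemma posterior_le_1: "posterior Prior p n A x \<le> 1"
\<comment> \<open>An infinite evidence is turned into the denominator 0 by \<open>enn2real\<close>,
  so the quotient is then 0.\<close>
proof (cases "(\<integral>\<^sup>+ z. ennreal (p n (fst z) (snd z) x) \<partial>Prior) = \<top>")
  case False
  have "(\<integral>\<^sup>+ z. indicator A z * ennreal (p n (fst z) (snd z) x) \<partial>Prior) \<le> (\<integral>\<^sup>+ z. ennreal (p n (fst z) (snd z) x) \<partial>Prior)"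
    by (intro nn_integral_mono) (auto simp: indicator_def)
  then have "enn2real (\<integral>\<^sup>+ z. indicator A z * ennreal (p n (fst z) (snd z) x) \<partial>Prior)
      \<le> enn2real (\<integral>\<^sup>+ z. ennreal (p n (fst z) (snd z) x) \<partial>Prior)"
    using False by (intro enn2real_mono) (auto simp: less_top)
  then show ?thesis
    unfolding posterior_def by (intro divide_le_eq_1[THEN iffD2]) (auto simp: less_le)
qed (simp add: posterior_def)

locale bayes_experiment =
  PT: prob_space PT + PH: prob_space PH + sample: sigma_finite_measure \<mu>
  for PT :: "'t::second_countable_topology measure" and PH :: "'h::topological_space measure" and \<mu> :: "'x measure" +
  fixes p :: "nat \<Rightarrow> 't \<Rightarrow> 'h \<Rightarrow> 'x \<Rightarrow> real" and n :: nat and \<Theta> :: "'t set"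
  assumes sets_PT: "sets PT = sets borel" and sets_PH: "sets PH = sets borel"
    and joint_measurable: "(\<lambda>(z, x). p n (fst z) (snd z) x) \<in> borel_measurable ((borel \<Otimes>\<^sub>M borel) \<Otimes>\<^sub>M \<mu>)"
    and \<Theta>_borel: "\<Theta> \<in> sets borel" and PT_\<Theta>: "emeasure PT \<Theta> = 1"
    and probability: "\<And>t e. t \<in> \<Theta> \<Longrightarrow> prob_space (density \<mu> (\<lambda>x. ennreal (p n t e x)))"
begin

lemma sets_prior [measurable_cong]: "sets (PT \<Otimes>\<^sub>M PH) = sets (borel \<Otimes>\<^sub>M borel)"
  by (intro sets_pair_measure_cong sets_PT sets_PH)

sublocale prior: prob_space "PT \<Otimes>\<^sub>M PH"
  by (intro prob_space_pair PT.prob_space_axioms PH.prob_space_axioms)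

lemma likelihood_measurable:
  assumes "x \<in> space \<mu>"
  shows "(\<lambda>z. p n (fst z) (snd z) x) \<in> borel_measurable (borel \<Otimes>\<^sub>M borel)"
  using measurable_compose[OF measurable_Pair2'[OF assms] joint_measurable]
  by (rule back_subst[of "\<lambda>f. f \<in> _"]) auto

lemma density_measurable: "(\<lambda>x. p n t e x) \<in> borel_measurable \<mu>"
  using measurable_compose[OF measurable_Pair1'[of "(t, e)" "borel \<Otimes>\<^sub>M borel" \<mu>] joint_measurable]
  by (simp add: space_pair_measure)

lemma weighted_mass_measurable:
  assumes [measurable]: "A \<in> sets (borel \<Otimes>\<^sub>M borel)"
  shows "(\<lambda>x. \<integral>\<^sup>+ z. indicator A z * ennreal (p n (fst z) (snd z) x) \<partial>(PT \<Otimes>\<^sub>M PH)) \<in> borel_measurable \<mu>"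
proof (rule prior.borel_measurable_nn_integral)
  have "(\<lambda>y. case (\<lambda>(x, z). (z, x)) y of (z, x) \<Rightarrow> p n (fst z) (snd z) x) \<in> borel_measurable (\<mu> \<Otimes>\<^sub>M (borel \<Otimes>\<^sub>M borel))"
    by (rule measurable_compose[OF measurable_pair_swap' joint_measurable])
  then have [measurable]: "(\<lambda>y. p n (fst (snd y)) (snd (snd y)) (fst y)) \<in> borel_measurable (\<mu> \<Otimes>\<^sub>M (borel \<Otimes>\<^sub>M borel))"
    by (simp add: case_prod_beta)
  show "(\<lambda>(x, z). indicator A z * ennreal (p n (fst z) (snd z) x)) \<in> borel_measurable (\<mu> \<Otimes>\<^sub>M (PT \<Otimes>\<^sub>M PH))"
    unfolding case_prod_beta by measurable
qed

lemma evidence_measurable: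
  "(\<lambda>x. \<integral>\<^sup>+ z. ennreal (p n (fst z) (snd z) x) \<partial>(PT \<Otimes>\<^sub>M PH)) \<in> borel_measurable \<mu>"
proof -
  have "UNIV \<in> sets ((borel :: 't measure) \<Otimes>\<^sub>M (borel :: 'h measure))"
    using sets.top[of "borel \<Otimes>\<^sub>M borel"] by (simp add: space_pair_measure)
  from weighted_mass_measurable[OF this] show ?thesis by simp
qed

lemma posterior_measurable:
  assumes "A \<in> sets (borel \<Otimes>\<^sub>M borel)"
  shows "posterior (PT \<Otimes>\<^sub>M PH) p n A \<in> borel_measurable \<mu>"
proof -
  from evidence_measurable weighted_mass_measurable[OF assms] show ?thesis unfolding posterior_def[abs_def] by measurable
qed

text \<open>By Tonelli the evidence integrates to 1 over the sample space. The densities are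
  normalised only for parameters in \<open>\<Theta>\<close>, but the prior gives full mass to
  those.\<close>

lemma evidence_finite: "AE x in \<mu>. (\<integral>\<^sup>+ z. ennreal (p n (fst z) (snd z) x) \<partial>(PT \<Otimes>\<^sub>M PH)) \<noteq> \<top>"
proof -
  interpret pair_sigma_finite "PT \<Otimes>\<^sub>M PH" \<mu> ..
  note [measurable] = \<Theta>_borel
  have [measurable]: "(\<lambda>(z, x). p n (fst z) (snd z) x) \<in> borel_measurable ((PT \<Otimes>\<^sub>M PH) \<Otimes>\<^sub>M \<mu>)"
    using joint_measurable by measurable
  have AE: "AE z in PT \<Otimes>\<^sub>M PH. fst z \<in> \<Theta>"
  proof -
    have sp: "space PT = UNIV" "space PH = UNIV"
      using sets_eq_imp_space_eq[OF sets_PT] sets_eq_imp_space_eq[OF sets_PH] by simp_all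
    have "emeasure PT (- \<Theta>) = 0"
      using emeasure_compl[of \<Theta> PT] \<Theta>_borel PT_\<Theta> PT.emeasure_space_1
      by (simp add: sets_PT sp Compl_eq_Diff_UNIV)
    then have "emeasure (PT \<Otimes>\<^sub>M PH) ((- \<Theta>) \<times> UNIV) = 0"
      using \<Theta>_borel by (subst PH.emeasure_pair_measure_Times) (auto simp: sets_PT sets_PH)
    moreover have "(- \<Theta>) \<times> UNIV \<in> sets (PT \<Otimes>\<^sub>M PH)"
      using \<Theta>_borel by (intro pair_measureI) (auto simp: sets_PT sets_PH)
    ultimately show ?thesis by (intro AE_I'[of "(- \<Theta>) \<times> UNIV"]) (auto simp: null_sets_def)
  qed
  have "(\<integral>\<^sup>+ x. \<integral>\<^sup>+ z. ennreal (p n (fst z) (snd z) x) \<partial>(PT \<Otimes>\<^sub>M PH) \<partial>\<mu>) =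
      (\<integral>\<^sup>+ z. \<integral>\<^sup>+ x. ennreal (p n (fst z) (snd z) x) \<partial>\<mu> \<partial>(PT \<Otimes>\<^sub>M PH))"
    by (rule Fubini') (use joint_measurable in measurable)
  also have "\<dots> = (\<integral>\<^sup>+ z. 1 \<partial>(PT \<Otimes>\<^sub>M PH))"
  proof (rule nn_integral_cong_AE, use AE in eventually_elim)
    fix z :: "'t \<times> 'h" assume "fst z \<in> \<Theta>"
    from prob_space.emeasure_space_1[OF probability[OF this, of "snd z"]]
    show "(\<integral>\<^sup>+ x. ennreal (p n (fst z) (snd z) x) \<partial>\<mu>) = 1"
      using density_measurable by (subst (asm) emeasure_density) auto
  qed
  also have "\<dots> = 1" by (simp add: prior.emeasure_space_1)
  finally have "(\<integral>\<^sup>+ x. \<integral>\<^sup>+ z. ennreal (p n (fst z) (snd z) x) \<partial>(PT \<Otimes>\<^sub>M PH) \<partial>\<mu>) \<noteq> \<infinity>" by simp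
  then show ?thesis using nn_integral_noteq_infinite[OF evidence_measurable] by simp
qed

end

section \<open>Markov's inequality for outer probabilities and local flatness of the prior
  density\<close>

lemma (in prob_space) outer_prob_Markov:
  assumes "X \<in> borel_measurable M" "\<And>x. 0 \<le> X x" "\<And>x. X x \<le> 1" and c: "c > 0"
  shows "outer_prob M {x. X x > c} \<le> (\<integral>x. X x \<partial>M) / c"
proof -
  have int: "integrable M X" using assms by (intro integrable_const_bound[of _ 1]) auto
  have "outer_prob M {x. X x > c} \<le> prob {x \<in> space M. X x \<ge> c}"
    using assms(1) by (intro outer_prob_le) auto
  also have "\<dots> \<le> (\<integral>x. X x \<partial>M) / c"
    using assms by (intro integral_Markov_inequality_measure[OF int, of "{}"]) auto
  finally show ?thesis .
qed

lemma continuous_density_local_bounds: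
  fixes f :: "'a::euclidean_space \<Rightarrow> real"
  assumes U: "open U" "t0 \<in> U" "continuous_on U f" and pos: "f t0 > 0" and \<rho>: "\<rho> > 1"
  shows "eventually (\<lambda>n. \<forall>h. norm h \<le> M \<longrightarrow> t0 + (1 / sqrt (real n)) *\<^sub>R h \<in> U \<and>
    f t0 \<le> \<rho> * f (t0 + (1 / sqrt (real n)) *\<^sub>R h) \<and> f (t0 + (1 / sqrt (real n)) *\<^sub>R h) \<le> \<rho> * f t0) sequentially"
proof -
  have "(f \<longlongrightarrow> f t0) (at t0)"
    using U continuous_on_eq_continuous_at isCont_def by blast
  moreover have "f t0 / \<rho> < f t0" "f t0 < \<rho> * f t0" using pos \<rho> by (simp_all add: divide_less_eq)
  ultimately have "eventually (\<lambda>t. f t0 / \<rho> < f t \<and> f t < \<rho> * f t0) (at t0)"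
    by (intro eventually_conj order_tendstoD)
  moreover have "eventually (\<lambda>t. t \<in> U) (at t0)" using U(1,2) by (simp add: eventually_at_topological) blast
  ultimately have "eventually (\<lambda>t. t \<in> U \<and> f t0 / \<rho> < f t \<and> f t < \<rho> * f t0) (at t0)"
    by eventually_elim auto
  then obtain d where d: "d > 0" "\<And>t. t \<noteq> t0 \<Longrightarrow> dist t t0 < d \<Longrightarrow> t \<in> U \<and> f t0 / \<rho> < f t \<and> f t < \<rho> * f t0"
    unfolding eventually_at by auto
  have near: "t \<in> U \<and> f t0 \<le> \<rho> * f t \<and> f t \<le> \<rho> * f t0" if "dist t t0 < d" for t
    using d(2)[of t] that U(2) pos \<rho> by (cases "t = t0") (auto simp: divide_less_eq mult.commute)
  have "(\<lambda>n. M / sqrt (real n)) \<longlonglongrightarrow> 0"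
    by (intro real_tendsto_divide_at_top[of _ M] tendsto_const filterlim_compose[OF sqrt_at_top] filterlim_real_sequentially)
  then have "eventually (\<lambda>n. M / sqrt (real n) < d) sequentially"
    using d(1) by (rule order_tendstoD)
  then show ?thesis
  proof eventually_elim
    case (elim n)
    show ?case
    proof (intro allI impI near)
      fix h :: 'a assume "norm h \<le> M"
      then have "norm h / sqrt (real n) \<le> M / sqrt (real n)" by (intro divide_right_mono) auto
      with elim show "dist (t0 + (1 / sqrt (real n)) *\<^sub>R h) t0 < d" by (simp add: dist_norm)
    qed
  qed
qed

section \<open>Choice of constants and exceptional events\<close>

theorem theorem1:
  fixes \<Theta> :: "(real ^ 'p) set"
    and \<theta>0 :: "real ^ 'p"
    and \<eta>0 :: "'h :: metric_space"
    and \<mu> :: "nat \<Rightarrow> 'x measure"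
    and p :: "nat \<Rightarrow> real ^ 'p \<Rightarrow> 'h \<Rightarrow> 'x \<Rightarrow> real"
    and Pi\<Theta> :: "(real ^ 'p) measure"
    and PiH :: "'h measure"
    and H :: "nat \<Rightarrow> 'h set"
    and ldot :: "nat \<Rightarrow> 'h \<Rightarrow> 'x \<Rightarrow> real ^ 'p"
    and V :: "nat \<Rightarrow> 'h \<Rightarrow> real ^ 'p ^ 'p"
  defines "P0 \<equiv> \<lambda>n. density (\<mu> n) (\<lambda>x. ennreal (p n \<theta>0 \<eta>0 x))"
      and "Prior \<equiv> Pi\<Theta> \<Otimes>\<^sub>M PiH"
  assumes sigma_fin: "\<And>n. sigma_finite_measure (\<mu> n)"
    and p_nonneg: "\<And>n t e x. p n t e x \<ge> 0"
    and p_meas: "\<And>n. (\<lambda>(z, x). p n (fst z) (snd z) x)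
                      \<in> borel_measurable ((borel \<Otimes>\<^sub>M borel) \<Otimes>\<^sub>M \<mu> n)"
    and p_prob: "\<And>n t e. t \<in> \<Theta> \<Longrightarrow> prob_space (density (\<mu> n) (\<lambda>x. ennreal (p n t e x)))"
    and \<Theta>_borel: "\<Theta> \<in> sets borel"
    and \<theta>0_in: "\<theta>0 \<in> \<Theta>"
    and prior\<Theta>: "prob_space Pi\<Theta>" "sets Pi\<Theta> = sets borel" "emeasure Pi\<Theta> \<Theta> = 1"
    and priorH: "prob_space PiH" "sets PiH = sets borel"
    and thick: "thick_at Pi\<Theta> \<theta>0"
    and H_meas: "\<And>n. H n \<in> sets borel"
    and ldot_L2: "\<And>n e i. (\<lambda>x. ldot n e x $ i) \<in> borel_measurable (\<mu> n)"
                 "\<And>n e i. integrable (P0 n) (\<lambda>x. (ldot n e x $ i)\<^sup>2)"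
    and LAN: "\<And>K \<epsilon>. compact K \<Longrightarrow> \<epsilon> > 0 \<Longrightarrow>
       (\<lambda>n. outer_prob (P0 n)
          {x. \<exists>h\<in>K. \<exists>e\<in>H n.
              \<not> (p n (\<theta>0 + (1 / sqrt (real n)) *\<^sub>R h) e x > 0 \<and> p n \<theta>0 e x > 0 \<and>
                  \<bar>ln (p n (\<theta>0 + (1 / sqrt (real n)) *\<^sub>R h) e x / p n \<theta>0 e x)
                    - (h \<bullet> ldot n e x) / sqrt (real n)
                    + (h \<bullet> (V n e *v h)) / 2\<bar> \<le> \<epsilon>)})
       \<longlonglongrightarrow> 0"
    and condA_score: "\<And>\<epsilon>. \<epsilon> > 0 \<Longrightarrow>
       (\<lambda>n. outer_prob (P0 n)
          {x. \<exists>e\<in>H n. norm (ldot n e x - ldot n \<eta>0 x) > \<epsilon> * sqrt (real n)})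
       \<longlonglongrightarrow> 0"
    and condA_V: "\<And>\<epsilon>. \<epsilon> > 0 \<Longrightarrow>
       eventually (\<lambda>n. \<forall>e\<in>H n. onorm (\<lambda>v. (V n e - V n \<eta>0) *v v) \<le> \<epsilon>) sequentially"
    and V_sym: "\<And>n. transpose (V n \<eta>0) = V n \<eta>0"
    and condA_eig: "0 < liminf (\<lambda>n. ereal (rho_min (V n \<eta>0)))"
                   "liminf (\<lambda>n. ereal (rho_min (V n \<eta>0)))
                      \<le> limsup (\<lambda>n. ereal (rho_max (V n \<eta>0)))"
                   "limsup (\<lambda>n. ereal (rho_max (V n \<eta>0))) < \<infinity>"
    and condB_H: "(\<lambda>n. \<integral>x. posterior Prior p n {z. snd z \<in> H n} x \<partial>P0 n) \<longlonglongrightarrow> 1"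
    and condB_rate: "\<And>M :: nat \<Rightarrow> real. mono M \<Longrightarrow> filterlim M at_top sequentially \<Longrightarrow>
       (\<lambda>n. \<integral>x. posterior Prior p n {z. sqrt (real n) * norm (fst z - \<theta>0) > M n} x \<partial>P0 n)
       \<longlonglongrightarrow> 0"
  shows "\<And>\<epsilon>. \<epsilon> > 0 \<Longrightarrow>
    (\<lambda>n. outer_prob (P0 n)
       {x. \<exists>B \<in> sets (borel :: (real ^ 'p) measure).
          \<bar>posterior Prior p n {z. sqrt (real n) *\<^sub>R (fst z - \<theta>0) \<in> B} x
           - measure (mvnormal ((1 / sqrt (real n)) *\<^sub>R (matrix_inv (V n \<eta>0) *v ldot n \<eta>0 x))
                               (matrix_inv (V n \<eta>0))) B\<bar> > \<epsilon>})
    \<longlonglongrightarrow> 0"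
proof -
  fix \<epsilon> :: real assume \<epsilon>: "\<epsilon> > 0"
  define bad where "bad n = {x. \<exists>B \<in> sets (borel :: (real ^ 'p) measure).
      \<bar>posterior Prior p n {z. sqrt (real n) *\<^sub>R (fst z - \<theta>0) \<in> B} x
       - measure (mvnormal ((1 / sqrt (real n)) *\<^sub>R (matrix_inv (V n \<eta>0) *v ldot n \<eta>0 x))
                           (matrix_inv (V n \<eta>0))) B\<bar> > \<epsilon>}" for n
  have bayes: "bayes_experiment Pi\<Theta> PiH (\<mu> n) p n \<Theta>" for n
    unfolding bayes_experiment_def bayes_experiment_axioms_def
    using prior\<Theta> priorH sigma_fin p_meas \<Theta>_borel p_prob by auto
  interpret P0: prob_space "P0 n" for n
    unfolding P0_def by (rule p_prob[OF \<theta>0_in])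
  have space_P0: "space (P0 n) = space (\<mu> n)" and sets_P0: "sets (P0 n) = sets (\<mu> n)" for n
    by (simp_all add: P0_def)
  have post_meas: "posterior Prior p n A \<in> borel_measurable (P0 n)" if "A \<in> sets (borel \<Otimes>\<^sub>M borel)" for n A
    using bayes_experiment.posterior_measurable[OF bayes that] by (simp add: P0_def Prior_def)

  obtain U f where U: "open U" "\<theta>0 \<in> U" "continuous_on U f" "\<And>t. t \<in> U \<Longrightarrow> f t > 0"
    and dens: "\<And>A. A \<in> sets borel \<Longrightarrow> A \<subseteq> U \<Longrightarrow> emeasure Pi\<Theta> A = (\<integral>\<^sup>+ t\<in>A. ennreal (f t) \<partial>lborel)"
    using thick unfolding thick_at_def by blast

  \<comment> \<open>Bounds strictly inside the limits hold for all large \<open>n\<close>, so fixed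
    numbers can replace the eigenvalues.\<close>
  obtain lmin where lmin: "0 < ereal lmin" "ereal lmin < liminf (\<lambda>n. ereal (rho_min (V n \<eta>0)))"
    using ereal_dense2[OF condA_eig(1)] by blast
  obtain lmax0 where lmax0: "limsup (\<lambda>n. ereal (rho_max (V n \<eta>0))) < ereal lmax0"
    using ereal_dense2[OF condA_eig(3)] by blast
  \<comment> \<open>The maximum with \<open>lmin\<close> makes \<open>lmax\<close> positive, which
    gives \<open>C0 \<ge> 1\<close> without reference to any \<open>n\<close>.\<close>
  define lmax where "lmax = max lmin lmax0"
  have ev_form: "eventually (\<lambda>n. pos_def_form (V n \<eta>0) lmin lmax) sequentially"
    using less_LiminfD[OF lmin(2)] Limsup_lessD[OF lmax0]
  proof eventually_elim
    case (elim n)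
    show ?case
    proof
      show "transpose (V n \<eta>0) = V n \<eta>0" by (rule V_sym)
      show "lmin > 0" using lmin by simp
      show "lmin * (norm x)\<^sup>2 \<le> x \<bullet> (V n \<eta>0 *v x)" for x
        using elim(1) mult_right_mono[of lmin "rho_min (V n \<eta>0)" "(norm x)\<^sup>2"]
          rho_min_le_quadratic_form[OF V_sym, of n x] by simp
      show "x \<bullet> (V n \<eta>0 *v x) \<le> lmax * (norm x)\<^sup>2" for x
      proof -
        have "rho_max (V n \<eta>0) \<le> lmax" using elim(2) by (simp add: lmax_def)
        then have "rho_max (V n \<eta>0) * (norm x)\<^sup>2 \<le> lmax * (norm x)\<^sup>2" by (rule mult_right_mono) simp
        then show ?thesis using quadratic_form_le_rho_max[OF V_sym, of x n] by linarith
      qed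
    qed
  qed

  \<comment> \<open>The three error terms of \<open>posterior_normal_distance\<close> get
    \<open>\<epsilon> / 4\<close> each. The divisor 8 in \<open>\<eta>\<close> arises because the
    squared product of exp (3 \<eta>) and exp \<eta> is exp (8 \<eta>), which is thereby
    \<open>1 + r\<close>.\<close>
  define r where "r = min (\<epsilon> / 4) (1 / 8)"
  define \<eta> where "\<eta> = ln (1 + r) / 8"
  define \<delta> where "\<delta> = min (\<epsilon> / 8) (1 / 8)"
  have r: "r > 0" "r \<le> \<epsilon> / 4" "r \<le> 1 / 8" using \<epsilon> by (auto simp: r_def)
  have \<delta>: "\<delta> > 0" "2 * \<delta> \<le> \<epsilon> / 4" "\<delta> \<le> 1 / 8" using \<epsilon> by (auto simp: \<delta>_def)
  have \<eta>: "\<eta> > 0" using r by (simp add: \<eta>_def)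
  define \<rho>1 where "\<rho>1 = exp (3 * \<eta>)"
  define \<rho>2 where "\<rho>2 = exp \<eta>"
  have \<rho>_sq: "(\<rho>1 * \<rho>2)\<^sup>2 = 1 + r"
  proof -
    have "(\<rho>1 * \<rho>2)\<^sup>2 = exp (8 * \<eta>)" by (simp add: \<rho>1_def \<rho>2_def power2_eq_square flip: exp_add)
    then show ?thesis using r by (simp add: \<eta>_def)
  qed
  have \<rho>: "\<rho>1 > 0" "\<rho>2 > 1" "\<rho>1 * \<rho>2 \<ge> 1"
    using \<eta> by (simp_all add: \<rho>1_def \<rho>2_def flip: exp_add)

  define C0 where "C0 = 3 + 4 * lmax / lmin"
  have C0: "C0 \<ge> 1" using lmin by (simp add: C0_def lmax_def)
  \<comment> \<open>With \<open>exp y \<ge> y\<close> the tail is at most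
    \<open>sqrt 2 ^ CARD('p) / y\<close>, and \<open>y \<ge> lmin * k / 16\<close> once
    \<open>k \<ge> 1\<close>. Requiring this to be at most \<open>\<epsilon> / 4\<close> gives the
    factor 64; \<open>Suc\<close> secures \<open>k \<ge> 1\<close>.\<close>
  define k1 where "k1 = Suc (nat \<lceil>64 * sqrt 2 ^ CARD('p) / (lmin * \<epsilon>)\<rceil>)"
  have tail: "sqrt 2 ^ CARD('p) * exp (- lmin * (2 * C0 * real k)\<^sup>2 / 16) \<le> \<epsilon> / 4" if "k \<ge> k1" for k
  proof -
    define y where "y = lmin * (2 * C0 * real k)\<^sup>2 / 16"
    have k: "real k \<ge> 1" "64 * sqrt 2 ^ CARD('p) / (lmin * \<epsilon>) \<le> real k"
      using that real_nat_ceiling_ge[of "64 * sqrt 2 ^ CARD('p) / (lmin * \<epsilon>)"] by (auto simp: k1_def)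
    have "real k * 1 \<le> real k * (4 * C0\<^sup>2 * real k)"
      using k C0 mult_mono[of 1 "4 * C0\<^sup>2" 1 "real k"] one_le_power[OF C0, of 2] by (intro mult_left_mono) auto
    then have "lmin * real k \<le> 16 * y"
      using lmin by (simp add: y_def power_mult_distrib power2_eq_square ac_simps)
    then have "lmin * real k * \<epsilon> \<le> 16 * y * \<epsilon>" using \<epsilon> by (intro mult_right_mono) auto
    moreover have "64 * sqrt 2 ^ CARD('p) \<le> real k * (lmin * \<epsilon>)"
      using k(2) lmin \<epsilon> by (simp add: pos_divide_le_eq)
    ultimately have "4 * sqrt 2 ^ CARD('p) \<le> y * \<epsilon>"
      by (simp only: ac_simps)
    also have "\<dots> \<le> exp y * \<epsilon>"
      using order_trans[OF _ exp_ge_add_one_self, of y y] \<epsilon> by (intro mult_right_mono) auto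
    finally have "sqrt 2 ^ CARD('p) \<le> \<epsilon> / 4 * exp y" by (simp add: ac_simps)
    then have "sqrt 2 ^ CARD('p) / exp y \<le> \<epsilon> / 4" by (subst pos_divide_le_eq) simp_all
    moreover have "- lmin * (2 * C0 * real k)\<^sup>2 / 16 = - y" by (simp add: y_def)
    ultimately show ?thesis by (simp only: exp_minus divide_inverse)
  qed

  have "eventually (\<lambda>n. outer_prob (P0 n) (bad n) < \<tau>) sequentially" if \<tau>: "\<tau> > 0" for \<tau>
  proof -
    \<comment> \<open>Four events get \<open>\<tau> / 4\<close> each. Markov's inequality at level
      \<open>\<delta>\<close> divides by \<open>\<delta>\<close>, so expectations must be controlled
      up to \<open>\<tau> / 4 * \<delta>\<close>. Here \<open>\<delta>\<close> depends on
      \<open>\<epsilon>\<close> alone, while the radius \<open>k\<close> also depends on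
      \<open>\<tau>\<close>.\<close>
    have \<tau>4: "\<tau> / 4 > 0" and \<tau>\<delta>: "\<tau> / 4 * \<delta> > 0" using \<tau> \<delta> by auto
    obtain k where k: "k \<ge> k1" and ev_rate: "eventually (\<lambda>n. (\<integral>x. posterior Prior p n
        {z. sqrt (real n) * norm (fst z - \<theta>0) > real k} x \<partial>P0 n) < \<tau> / 4 * \<delta>) sequentially"
      using diverging_radii_imp_fixed_radius[where ?k1.0 = k1 and a = "\<lambda>n R. \<integral>x. posterior Prior p n
          {z. sqrt (real n) * norm (fst z - \<theta>0) > R} x \<partial>P0 n", OF condB_rate \<tau>\<delta>] by blast
    define M where "M = 2 * C0 * real k"
    have k0: "real k > 0" using k by (simp add: k1_def)
    have M: "M > 0" using k0 C0 by (simp add: M_def)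
    \<comment> \<open>The tolerances in Condition A are fixed only after \<open>M\<close>: for
      \<open>norm h \<le> M\<close> they turn into errors of at most \<open>\<eta>\<close> in the
      log-likelihood.\<close>
    define \<eta>1 where "\<eta>1 = \<eta> / M"
    define \<eta>2 where "\<eta>2 = 2 * \<eta> / M\<^sup>2"
    have \<eta>12: "\<eta>1 > 0" "\<eta>2 > 0" "\<eta>1 * M \<le> \<eta>" "\<eta>2 * M\<^sup>2 / 2 \<le> \<eta>"
      using \<eta> M by (simp_all add: \<eta>1_def \<eta>2_def)
    define E1 where "E1 n = {x. \<exists>h\<in>cball 0 M. \<exists>e\<in>H n.
              \<not> (p n (\<theta>0 + (1 / sqrt (real n)) *\<^sub>R h) e x > 0 \<and> p n \<theta>0 e x > 0 \<and>
                  \<bar>ln (p n (\<theta>0 + (1 / sqrt (real n)) *\<^sub>R h) e x / p n \<theta>0 e x)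
                    - (h \<bullet> ldot n e x) / sqrt (real n)
                    + (h \<bullet> (V n e *v h)) / 2\<bar> \<le> \<eta>)}" for n
    define E2 where "E2 n = {x. \<exists>e\<in>H n. norm (ldot n e x - ldot n \<eta>0 x) > \<eta>1 * sqrt (real n)}" for n
    define E3 where "E3 n = {x. 1 - posterior Prior p n {z. snd z \<in> H n} x > \<delta>}" for n
    define E4 where "E4 n = {x. posterior Prior p n {z. sqrt (real n) * norm (fst z - \<theta>0) > real k} x > \<delta>}" for n
    \<comment> \<open>On this event the posterior is 0 merely by convention; it is negligible by
      \<open>evidence_finite\<close>.\<close>
    define E5 where "E5 n = {x. (\<integral>\<^sup>+ z. ennreal (p n (fst z) (snd z) x) \<partial>Prior) = \<top>}" for n
    have ev1: "eventually (\<lambda>n. outer_prob (P0 n) (E1 n) < \<tau> / 4) sequentially"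
      unfolding E1_def by (rule order_tendstoD(2)[OF LAN[OF compact_cball \<eta>] \<tau>4])
    have ev2: "eventually (\<lambda>n. outer_prob (P0 n) (E2 n) < \<tau> / 4) sequentially"
      unfolding E2_def by (rule order_tendstoD(2)[OF condA_score[OF \<eta>12(1)] \<tau>4])
    have ev3: "eventually (\<lambda>n. outer_prob (P0 n) (E3 n) < \<tau> / 4) sequentially"
    proof -
      have "eventually (\<lambda>n. 1 - \<tau> / 4 * \<delta> < (\<integral>x. posterior Prior p n {z. snd z \<in> H n} x \<partial>P0 n)) sequentially"
        using \<tau>\<delta> by (intro order_tendstoD(1)[OF condB_H]) simp
      then show ?thesis
      proof eventually_elim
        case (elim n)
        let ?X = "posterior Prior p n {z. snd z \<in> H n}"
        have "{z \<in> space (borel \<Otimes>\<^sub>M borel). snd z \<in> H n} \<in> sets ((borel :: (real ^ 'p) measure) \<Otimes>\<^sub>M (borel :: 'h measure))"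
          using H_meas by measurable
        then have "{z. snd z \<in> H n} \<in> sets ((borel :: (real ^ 'p) measure) \<Otimes>\<^sub>M (borel :: 'h measure))"
          by (simp add: space_pair_measure)
        then have X: "?X \<in> borel_measurable (P0 n)" by (rule post_meas)
        have "integrable (P0 n) ?X"
          using X by (intro P0.integrable_const_bound[of _ 1]) (auto simp: posterior_nonneg posterior_le_1)
        then have "(\<integral>x. 1 - ?X x \<partial>P0 n) = 1 - (\<integral>x. ?X x \<partial>P0 n)"
          by (simp add: P0.prob_space)
        moreover have "outer_prob (P0 n) (E3 n) \<le> (\<integral>x. 1 - ?X x \<partial>P0 n) / \<delta>"
          unfolding E3_def using X \<delta>
          by (intro P0.outer_prob_Markov) (auto simp: posterior_nonneg posterior_le_1)
        moreover have "(1 - (\<integral>x. ?X x \<partial>P0 n)) / \<delta> < \<tau> / 4"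
          using elim \<delta> by (simp add: pos_divide_less_eq)
        ultimately show ?case by (metis le_less_trans)
      qed
    qed
    have ev4: "eventually (\<lambda>n. outer_prob (P0 n) (E4 n) < \<tau> / 4) sequentially"
      using ev_rate
    proof eventually_elim
      case (elim n)
      let ?A = "{z :: (real ^ 'p) \<times> 'h. sqrt (real n) * norm (fst z - \<theta>0) > real k}"
      have "{z \<in> space (borel \<Otimes>\<^sub>M borel). sqrt (real n) * norm (fst z - \<theta>0) > real k}
          \<in> sets ((borel :: (real ^ 'p) measure) \<Otimes>\<^sub>M (borel :: 'h measure))"
        by measurable
      then have "?A \<in> sets (borel \<Otimes>\<^sub>M borel)" by (simp add: space_pair_measure)
      then have X: "posterior Prior p n ?A \<in> borel_measurable (P0 n)" by (rule post_meas)
      have "outer_prob (P0 n) (E4 n) \<le> (\<integral>x. posterior Prior p n ?A x \<partial>P0 n) / \<delta>"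
        unfolding E4_def using X \<delta>
        by (intro P0.outer_prob_Markov) (auto simp: posterior_nonneg posterior_le_1)
      also have "\<dots> < \<tau> / 4" using elim \<delta> by (simp add: pos_divide_less_eq)
      finally show ?case .
    qed
    have E5: "outer_prob (P0 n) (E5 n) \<le> 0" for n
    proof -
      have "AE x in P0 n. x \<notin> E5 n"
        using bayes_experiment.evidence_finite[OF bayes, of n] bayes_experiment.density_measurable[OF bayes, of n]
        unfolding P0_def by (subst AE_density) (auto simp: E5_def Prior_def)
      then obtain N where N: "N \<in> null_sets (P0 n)" "{x \<in> space (P0 n). \<not> x \<notin> E5 n} \<subseteq> N"
        by (auto elim: AE_E simp: null_sets_def)
      have "outer_prob (P0 n) (E5 n) \<le> measure (P0 n) N"
        using N by (intro P0.outer_prob_le) auto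
      then show ?thesis using N(1) by (simp add: measure_eq_0_null_sets)
    qed
    have ev_f: "eventually (\<lambda>n. \<forall>h. norm h \<le> M \<longrightarrow> \<theta>0 + (1 / sqrt (real n)) *\<^sub>R h \<in> U \<and>
        f \<theta>0 \<le> \<rho>2 * f (\<theta>0 + (1 / sqrt (real n)) *\<^sub>R h) \<and> f (\<theta>0 + (1 / sqrt (real n)) *\<^sub>R h) \<le> \<rho>2 * f \<theta>0) sequentially"
      by (rule continuous_density_local_bounds[OF U(1,2,3) U(4)[OF U(2)] \<rho>(2)])
    show ?thesis
      using ev1 ev2 ev3 ev4 ev_f ev_form condA_V[OF \<eta>12(2)] eventually_gt_at_top[of 0]
    proof eventually_elim
      case (elim n)
      interpret pos_def_form "V n \<eta>0" lmin lmax by (rule elim)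
      let ?s = "sqrt (real n)"
      have s: "?s > 0" using elim by simp
      have "bad n \<inter> space (P0 n) \<subseteq> E1 n \<union> (E2 n \<union> (E3 n \<union> (E4 n \<union> E5 n)))"
      proof (rule subsetI, rule ccontr)
        fix x assume x: "x \<in> bad n \<inter> space (P0 n)" and good: "x \<notin> E1 n \<union> (E2 n \<union> (E3 n \<union> (E4 n \<union> E5 n)))"
        let ?l = "(1 / ?s) *\<^sub>R ldot n \<eta>0 x"
        let ?L = "\<lambda>h. exp (h \<bullet> ?l - h \<bullet> (V n \<eta>0 *v h) / 2)"
        let ?w = "\<lambda>t e. p n t e x"
        have wg: "?w (\<theta>0 + (1 / ?s) *\<^sub>R h) e \<le> \<rho>1 * (?L h * ?w \<theta>0 e)"
          "?L h * ?w \<theta>0 e \<le> \<rho>1 * ?w (\<theta>0 + (1 / ?s) *\<^sub>R h) e" if h: "norm h \<le> M" "e \<in> H n" for h e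
        proof -
          have lan: "?w (\<theta>0 + (1 / ?s) *\<^sub>R h) e > 0" "?w \<theta>0 e > 0"
            "\<bar>ln (?w (\<theta>0 + (1 / ?s) *\<^sub>R h) e / ?w \<theta>0 e) - (h \<bullet> ldot n e x) / ?s + (h \<bullet> (V n e *v h)) / 2\<bar> \<le> \<eta>"
            using good h by (auto simp: E1_def)
          have score: "norm (ldot n e x - ldot n \<eta>0 x) \<le> \<eta>1 * ?s"
            using good h by (force simp: E2_def)
          have info: "onorm (\<lambda>v. (V n e - V n \<eta>0) *v v) \<le> \<eta>2" using elim h by blast
          from local_likelihood_bounds[OF lan s h(1) score \<eta>12(3) info \<eta>12(4)]
          show "?w (\<theta>0 + (1 / ?s) *\<^sub>R h) e \<le> \<rho>1 * (?L h * ?w \<theta>0 e)"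
            "?L h * ?w \<theta>0 e \<le> \<rho>1 * ?w (\<theta>0 + (1 / ?s) *\<^sub>R h) e"
            by (simp_all add: \<rho>1_def)
        qed
        have xsp: "x \<in> space (\<mu> n)" using x by (simp add: space_P0)
        \<comment> \<open>None of the exceptional events involves \<open>B\<close>, so one good
          \<open>x\<close> serves all Borel sets at once; this yields the supremum.\<close>
        have dist: "\<bar>posterior Prior p n {z. ?s *\<^sub>R (fst z - \<theta>0) \<in> B} x
            - measure (mvnormal (matrix_inv (V n \<eta>0) *v ?l) (matrix_inv (V n \<eta>0))) B\<bar> \<le> \<epsilon>"
          if B: "B \<in> sets borel" for B
        proof -
          have "\<bar>posterior Prior p n {z. ?s *\<^sub>R (fst z - \<theta>0) \<in> B} x
            - measure (mvnormal (matrix_inv (V n \<eta>0) *v ?l) (matrix_inv (V n \<eta>0))) B\<bar>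
            \<le> 2 * \<delta> + ((\<rho>1 * \<rho>2)\<^sup>2 - 1) + sqrt 2 ^ CARD('p) * exp (- lmin * (2 * (3 + 4 * lmax / lmin) * real k)\<^sup>2 / 16)"
            unfolding posterior_def Prior_def
          proof (rule posterior_normal_distance[where w = ?w and f = f and U = U and H = "H n"
                and ?t0.0 = \<theta>0 and s = ?s and ?d0.0 = "f \<theta>0" and Q = PiH])
            show "(\<lambda>z. ?w (fst z) (snd z)) \<in> borel_measurable (borel \<Otimes>\<^sub>M borel)"
              by (rule bayes_experiment.likelihood_measurable[OF bayes xsp])
            show "(\<integral>\<^sup>+ z. ennreal (?w (fst z) (snd z)) \<partial>(Pi\<Theta> \<Otimes>\<^sub>M PiH)) \<noteq> \<top>"
              using good by (simp add: E5_def Prior_def)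
            show "1 - \<delta> \<le> enn2real (\<integral>\<^sup>+ z. indicator {z. snd z \<in> H n} z * ennreal (?w (fst z) (snd z)) \<partial>(Pi\<Theta> \<Otimes>\<^sub>M PiH))
                / enn2real (\<integral>\<^sup>+ z. ennreal (?w (fst z) (snd z)) \<partial>(Pi\<Theta> \<Otimes>\<^sub>M PiH))"
              using good by (simp add: E3_def Prior_def posterior_def)
            show "enn2real (\<integral>\<^sup>+ z. indicator {z. ?s * norm (fst z - \<theta>0) > real k} z * ennreal (?w (fst z) (snd z)) \<partial>(Pi\<Theta> \<Otimes>\<^sub>M PiH))
                / enn2real (\<integral>\<^sup>+ z. ennreal (?w (fst z) (snd z)) \<partial>(Pi\<Theta> \<Otimes>\<^sub>M PiH)) \<le> \<delta>"
              using good by (simp add: E4_def Prior_def posterior_def)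
            show "(\<rho>1 * \<rho>2)\<^sup>2 \<le> 9 / 8" using r by (simp add: \<rho>_sq)
          qed (use prior\<Theta> priorH U dens H_meas s p_nonneg k0 \<delta> \<rho> elim(5) wg B U(4)[OF U(2)] in
              \<open>auto simp: M_def C0_def less_imp_le\<close>)
          also have "\<dots> \<le> \<epsilon>"
            using tail[OF k] r \<delta> unfolding \<rho>_sq C0_def by linarith
          finally show ?thesis .
        qed
        have "matrix_inv (V n \<eta>0) *v ?l = (1 / ?s) *\<^sub>R (matrix_inv (V n \<eta>0) *v ldot n \<eta>0 x)"
          by (rule matrix_vector_mult_scaleR)
        with dist have "x \<notin> bad n" by (auto simp: bad_def not_less)
        with x show False by blast
      qed
      then have "outer_prob (P0 n) (bad n) \<le> outer_prob (P0 n) (E1 n \<union> (E2 n \<union> (E3 n \<union> (E4 n \<union> E5 n))))"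
        by (rule P0.outer_prob_mono)
      also have "\<dots> \<le> outer_prob (P0 n) (E1 n) + (outer_prob (P0 n) (E2 n) +
          (outer_prob (P0 n) (E3 n) + (outer_prob (P0 n) (E4 n) + outer_prob (P0 n) (E5 n))))"
        by (meson P0.outer_prob_Un add_left_mono order_trans)
      also have "\<dots> < \<tau>" using elim(1-4) E5[of n] by linarith
      finally show ?case .
    qed
  qed
  then have "(\<lambda>n. outer_prob (P0 n) (bad n)) \<longlonglongrightarrow> 0"
    by (intro order_tendstoI)
      (auto intro!: always_eventually less_le_trans[OF _ P0.outer_prob_nonneg])
  then show "(\<lambda>n. outer_prob (P0 n) {x. \<exists>B \<in> sets (borel :: (real ^ 'p) measure).
      \<bar>posterior Prior p n {z. sqrt (real n) *\<^sub>R (fst z - \<theta>0) \<in> B} x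
       - measure (mvnormal ((1 / sqrt (real n)) *\<^sub>R (matrix_inv (V n \<eta>0) *v ldot n \<eta>0 x))
                           (matrix_inv (V n \<eta>0))) B\<bar> > \<epsilon>}) \<longlonglongrightarrow> 0"
    unfolding bad_def .
qed

end
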